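(* Let $\mathcal{L}$ be a finite lattice with minimal element $\hat{0}$ and maximal element $\hat{1}$, let $\overline{\mathcal{L}} = \mathcal{L} \setminus \{\hat{0}\}$, and let $i_1, i_2 \geq 1$ and $0 \leq k \leq \min\{i_1,i_2\}$ be integers. If $\hat{1} \in \overline{\mathcal{L}}$ is an $(i_1+i_2-k-1)$-synor of $\overline{\mathcal{L}}$, then there is an $(i_1-1)$-synor $x$ of $\overline{\mathcal{L}}$ and an $(i_2-1)$-synor $y$ of $\overline{\mathcal{L}}$ such that $\hat{1} = x \vee y$.
   Context: Fix a field $\mathbb{K}$. The homology $\widetilde{H}_*$ of a poset is the reduced simplicial homology, with coefficients in $\mathbb{K}$, of its order complex (the simplicial complex of totally ordered subsets); in particular $\widetilde{H}_{-1}(\emptyset)=\mathbb{K}$. For a finite poset $\mathcal{P}$ and $x \in \mathcal{P}$ let $\mathcal{P}_{<x} = \{y \in \mathcal{P} : y < x\}$. An $i$-synor of $\mathcal{P}$ is an element $x \in \mathcal{P}$ with $\widetilde{H}_{i-1}(\mathcal{P}_{<x}) \neq 0$. $x \vee y$ denotes the join in $\mathcal{L}$. *)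

theory Defs
  imports "HOL-Algebra.Elementary_Groups"
begin

text \<open>
  Reduced simplicial homology, with coefficients in a field, of the order complex of a finite
  poset. Posets are finite subsets of an ordered type. The empty simplex belongs to every order
  complex and has dimension \<open>-1\<close>, which makes the chain complex the augmented one.
\<close>

definition order_complex :: "'a::order set \<Rightarrow> 'a set set" where
  "order_complex P = {\<sigma>. \<sigma> \<subseteq> P \<and> finite \<sigma> \<and> totalp_on \<sigma> (\<le>)}"

text \<open>
  A chain of the complex \<open>\<Delta>\<close> is represented by its coefficient function on simplices.
  Finite support is not imposed: these definitions are only meant for finite \<open>\<Delta>\<close>.
\<close>

definition simplicial_chain_group :: "'a set set \<Rightarrow> int \<Rightarrow> ('a set \<Rightarrow> 'k::field) monoid" where
  "simplicial_chain_group \<Delta> i =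
     \<lparr>carrier = {c. \<forall>\<sigma>. c \<sigma> \<noteq> 0 \<longrightarrow> \<sigma> \<in> \<Delta> \<and> int (card \<sigma>) = i + 1},
      mult = (\<lambda>c d \<sigma>. c \<sigma> + d \<sigma>),
      one = (\<lambda>_. 0)\<rparr>"

text \<open>
  Every simplex of an order complex is a chain \<open>v\<^sub>0 < \<dots> < v\<^sub>n\<close> and is oriented by that order.
  The boundary is the linear extension of
  \<open>\<partial>{v\<^sub>0, \<dots>, v\<^sub>n} = (\<Sum>j\<le>n. (-1)^j {v\<^sub>0, \<dots>, v\<^sub>n} - {v\<^sub>j})\<close>;
  the definition below gives its coefficient at \<open>\<tau>\<close>, and \<open>j\<close> is the number of vertices below \<open>v\<^sub>j\<close>.
\<close>

definition simplicial_boundary ::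
    "'a::order set set \<Rightarrow> ('a set \<Rightarrow> 'k::field) \<Rightarrow> 'a set \<Rightarrow> 'k" where
  "simplicial_boundary \<Delta> c =
     (\<lambda>\<tau>. \<Sum>\<sigma>\<in>\<Delta>. \<Sum>v | v \<in> \<sigma> \<and> \<sigma> - {v} = \<tau>. (-1) ^ card {w \<in> \<sigma>. w < v} * c \<sigma>)"

definition simplicial_cycles :: "'a::order set set \<Rightarrow> int \<Rightarrow> ('a set \<Rightarrow> 'k::field) set" where
  "simplicial_cycles \<Delta> i =
     {c \<in> carrier (simplicial_chain_group \<Delta> i). simplicial_boundary \<Delta> c = (\<lambda>_. 0)}"

definition simplicial_boundaries :: "'a::order set set \<Rightarrow> int \<Rightarrow> ('a set \<Rightarrow> 'k::field) set" where
  "simplicial_boundaries \<Delta> i =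
     simplicial_boundary \<Delta> ` carrier (simplicial_chain_group \<Delta> (i + 1))"

text \<open>
  Only the additive group of the homology vector space is recorded; this suffices to express
  that the homology is nonzero.
\<close>

definition poset_homology :: "int \<Rightarrow> 'a::order set \<Rightarrow> ('a set \<Rightarrow> 'k::field) set monoid" where
  "poset_homology i P =
     (simplicial_chain_group (order_complex P) i)
       \<lparr>carrier := simplicial_cycles (order_complex P) i\<rparr>
     Mod simplicial_boundaries (order_complex P) i"

text \<open>The first argument of \<open>synor\<close> is the coefficient field, given as a type.\<close>

definition synor :: "'k::field itself \<Rightarrow> int \<Rightarrow> 'a::order set \<Rightarrow> 'a \<Rightarrow> bool" where
  "synor K i P x \<longleftrightarrow>
     x \<in> P \<and>
     \<not> trivial_group (poset_homology (i - 1) {y \<in> P. y < x} :: ('a set \<Rightarrow> 'k) set monoid)"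


text \<open>
  The quotient above is a group for every finite poset, so that \<open>trivial_group\<close> fails only for
  nonzero homology; and the homology of the empty poset in degree \<open>-1\<close> is nonzero.
\<close>

lemma finite_order_complex: "finite P \<Longrightarrow> finite (order_complex P)"
  by (rule finite_subset[of _ "Pow P"]) (auto simp: order_complex_def)

lemma order_complex_subset: "\<sigma> \<in> order_complex P \<Longrightarrow> \<tau> \<subseteq> \<sigma> \<Longrightarrow> \<tau> \<in> order_complex P"
  unfolding order_complex_def by (auto intro: finite_subset totalp_on_subset)

lemma comm_group_simplicial_chain_group:
  "comm_group (simplicial_chain_group \<Delta> i :: ('a set \<Rightarrow> 'k::field) monoid)"
proof (rule comm_groupI)
  fix c :: "'a set \<Rightarrow> 'k" assume c: "c \<in> carrier (simplicial_chain_group \<Delta> i)"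
  show "\<exists>d\<in>carrier (simplicial_chain_group \<Delta> i).
          d \<otimes>\<^bsub>simplicial_chain_group \<Delta> i\<^esub> c = \<one>\<^bsub>simplicial_chain_group \<Delta> i\<^esub>"
    using c by (intro bexI[of _ "\<lambda>\<sigma>. - c \<sigma>"]) (auto simp: simplicial_chain_group_def)
next
  fix c d :: "'a set \<Rightarrow> 'k"
  assume "c \<in> carrier (simplicial_chain_group \<Delta> i)" "d \<in> carrier (simplicial_chain_group \<Delta> i)"
  then show "c \<otimes>\<^bsub>simplicial_chain_group \<Delta> i\<^esub> d \<in> carrier (simplicial_chain_group \<Delta> i)"
    by (simp add: simplicial_chain_group_def) (metis add_0)
qed (auto simp: simplicial_chain_group_def algebra_simps)

lemma simplicial_boundary_add:
  "simplicial_boundary \<Delta> (\<lambda>\<sigma>. c \<sigma> + d \<sigma>)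
   = (\<lambda>\<tau>. simplicial_boundary \<Delta> c \<tau> + simplicial_boundary \<Delta> d \<tau>)"
  by (simp add: simplicial_boundary_def distrib_left sum.distrib)

lemma simplicial_boundary_uminus:
  "simplicial_boundary \<Delta> (\<lambda>\<sigma>. - c \<sigma>) = (\<lambda>\<tau>. - simplicial_boundary \<Delta> c \<tau>)"
  by (simp add: simplicial_boundary_def sum_negf)

lemma simplicial_boundary_in_carrier:
  assumes "c \<in> carrier (simplicial_chain_group (order_complex P) (i + 1))"
  shows "simplicial_boundary (order_complex P) c
         \<in> carrier (simplicial_chain_group (order_complex P) i)"
proof -
  have "\<tau> \<in> order_complex P \<and> int (card \<tau>) = i + 1"
    if nz: "simplicial_boundary (order_complex P) c \<tau> \<noteq> 0" for \<tau>
  proof -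
    obtain \<sigma> where \<sigma>: "\<sigma> \<in> order_complex P"
      and s: "(\<Sum>v | v \<in> \<sigma> \<and> \<sigma> - {v} = \<tau>. (-1) ^ card {w \<in> \<sigma>. w < v} * c \<sigma>) \<noteq> 0"
      using nz unfolding simplicial_boundary_def by (meson sum.not_neutral_contains_not_neutral)
    obtain v where v: "v \<in> \<sigma>" "\<sigma> - {v} = \<tau>" and "c \<sigma> \<noteq> 0"
      using s by (auto elim: sum.not_neutral_contains_not_neutral)
    then have "int (card \<sigma>) = i + 2"
      using assms by (auto simp: simplicial_chain_group_def)
    moreover have "finite \<sigma>" using \<sigma> by (simp add: order_complex_def)
    ultimately have "int (card \<tau>) = i + 1"
      using v card_Suc_Diff1[of \<sigma> v] by simp
    then show ?thesis using order_complex_subset[OF \<sigma>] v by auto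
  qed
  then show ?thesis by (auto simp: simplicial_chain_group_def)
qed

lemma simplicial_boundary_boundary:
  fixes c :: "'a::order set \<Rightarrow> 'k::field"
  assumes fin: "finite P"
  shows "simplicial_boundary (order_complex P) (simplicial_boundary (order_complex P) c) = (\<lambda>_. 0)"
proof
  fix \<rho> :: "'a set"
  let ?D = "order_complex P"
  define s :: "'a set \<Rightarrow> 'a \<Rightarrow> 'k" where "s \<sigma> v = (-1) ^ card {w \<in> \<sigma>. w < v}" for \<sigma> v
  have finD: "finite ?D" and finS: "\<And>\<sigma>. \<sigma> \<in> ?D \<Longrightarrow> finite \<sigma>"
    using finite_order_complex[OF fin] by (auto simp: order_complex_def)
  define A where "A \<sigma> = {(w, v). w \<in> \<sigma> \<and> v \<in> \<sigma> \<and> w \<noteq> v \<and> \<sigma> - {w} - {v} = \<rho>}" for \<sigma> :: "'a set"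
  define g where "g \<sigma> = (\<lambda>(w, v). s (\<sigma> - {w}) v * s \<sigma> w * c \<sigma>)" for \<sigma>
  have cancel: "sum (g \<sigma>) (A \<sigma>) = 0" if \<sigma>: "\<sigma> \<in> ?D" for \<sigma>
  proof -
    define L where "L = {(w, v) \<in> A \<sigma>. w < v}"
    define U where "U = {(w, v) \<in> A \<sigma>. v < w}"
    have tot: "w < v \<or> v < w" if "w \<in> \<sigma>" "v \<in> \<sigma>" "w \<noteq> v" for v w
      using \<sigma> that by (auto simp: order_complex_def totalp_on_def less_le)
    have AU: "A \<sigma> = L \<union> U" "L \<inter> U = {}"
      using tot by (auto simp: L_def U_def A_def dest: less_asym)
    have "finite (A \<sigma>)"
      by (rule finite_subset[of _ "\<sigma> \<times> \<sigma>"]) (use finS[OF \<sigma>] in \<open>auto simp: A_def\<close>)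
    then have finLU: "finite L" "finite U" using AU by auto
    have sgn: "g \<sigma> (v, w) = - g \<sigma> (w, v)" if "(w, v) \<in> L" for w v
    proof -
      have wv: "w \<in> \<sigma>" "v \<in> \<sigma>" "w < v" using that by (auto simp: L_def A_def)
      have "{u \<in> \<sigma> - {v}. u < w} = {u \<in> \<sigma>. u < w}" using wv by (auto dest: less_asym)
      then have 1: "s (\<sigma> - {v}) w = s \<sigma> w" by (simp add: s_def)
      have "{u \<in> \<sigma>. u < v} = insert w {u \<in> \<sigma> - {w}. u < v}" using wv by auto
      then have "card {u \<in> \<sigma>. u < v} = Suc (card {u \<in> \<sigma> - {w}. u < v})"
        using finS[OF \<sigma>] by simp
      then have "s \<sigma> v = - s (\<sigma> - {w}) v" by (simp add: s_def)
      with 1 show ?thesis by (simp add: g_def)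
    qed
    have "sum (g \<sigma>) U = (\<Sum>(w, v)\<in>L. g \<sigma> (v, w))"
      by (rule sum.reindex_bij_witness[of _ "\<lambda>(w, v). (v, w)" "\<lambda>(w, v). (v, w)"])
         (auto simp: L_def U_def A_def)
    also have "\<dots> = (\<Sum>x\<in>L. - g \<sigma> x)"
      by (rule sum.cong) (auto simp: sgn)
    finally show ?thesis
      unfolding AU(1) by (simp add: sum.union_disjoint[OF finLU AU(2)] sum_negf)
  qed
  define B where "B = {(\<sigma>, v). \<sigma> \<in> ?D \<and> v \<in> \<sigma> \<and> \<sigma> - {v} = \<rho>}"
  have fin1: "finite {v. v \<in> \<sigma> \<and> \<sigma> - {v} = \<tau>}" if "\<sigma> \<in> ?D" for \<sigma> \<tau>
    using finS[OF that] by auto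
  have "simplicial_boundary ?D (simplicial_boundary ?D c) \<rho>
      = (\<Sum>\<sigma>\<in>?D. \<Sum>v | v \<in> \<sigma> \<and> \<sigma> - {v} = \<rho>. \<Sum>\<sigma>'\<in>?D. \<Sum>w | w \<in> \<sigma>' \<and> \<sigma>' - {w} = \<sigma>.
           s \<sigma> v * (s \<sigma>' w * c \<sigma>'))"
    by (simp add: simplicial_boundary_def s_def sum_distrib_left)
  also have "\<dots> = (\<Sum>\<sigma>\<in>?D. \<Sum>\<sigma>'\<in>?D. \<Sum>v | v \<in> \<sigma> \<and> \<sigma> - {v} = \<rho>. \<Sum>w | w \<in> \<sigma>' \<and> \<sigma>' - {w} = \<sigma>.
           s \<sigma> v * (s \<sigma>' w * c \<sigma>'))"
    by (intro sum.cong refl sum.swap)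
  also have "\<dots> = (\<Sum>\<sigma>'\<in>?D. \<Sum>\<sigma>\<in>?D. \<Sum>v | v \<in> \<sigma> \<and> \<sigma> - {v} = \<rho>. \<Sum>w | w \<in> \<sigma>' \<and> \<sigma>' - {w} = \<sigma>.
           s \<sigma> v * (s \<sigma>' w * c \<sigma>'))"
    by (rule sum.swap)
  also have "\<dots> = (\<Sum>\<sigma>'\<in>?D. sum (g \<sigma>') (A \<sigma>'))"
  proof (rule sum.cong[OF refl])
    fix \<sigma>' assume \<sigma>': "\<sigma>' \<in> ?D"
    have "(\<Sum>\<sigma>\<in>?D. \<Sum>v | v \<in> \<sigma> \<and> \<sigma> - {v} = \<rho>. \<Sum>w | w \<in> \<sigma>' \<and> \<sigma>' - {w} = \<sigma>.
             s \<sigma> v * (s \<sigma>' w * c \<sigma>'))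
        = (\<Sum>(\<sigma>, v, w)\<in>(SIGMA \<sigma>:?D. SIGMA v:{v. v \<in> \<sigma> \<and> \<sigma> - {v} = \<rho>}.
              {w. w \<in> \<sigma>' \<and> \<sigma>' - {w} = \<sigma>}). s \<sigma> v * (s \<sigma>' w * c \<sigma>'))"
      using finD finS \<sigma>' by (simp add: sum.Sigma)
    also have "\<dots> = sum (g \<sigma>') (A \<sigma>')"
      by (rule sum.reindex_bij_witness[of _ "\<lambda>(w, v). (\<sigma>' - {w}, v, w)" "\<lambda>(\<sigma>, v, w). (w, v)"])
         (auto simp: A_def g_def mult.assoc intro: order_complex_subset[OF \<sigma>'])
    finally show "(\<Sum>\<sigma>\<in>?D. \<Sum>v | v \<in> \<sigma> \<and> \<sigma> - {v} = \<rho>. \<Sum>w | w \<in> \<sigma>' \<and> \<sigma>' - {w} = \<sigma>.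
             s \<sigma> v * (s \<sigma>' w * c \<sigma>')) = sum (g \<sigma>') (A \<sigma>')" .
  qed
  also have "\<dots> = 0" by (simp add: cancel)
  finally show "simplicial_boundary ?D (simplicial_boundary ?D c) \<rho> = 0" .
qed

lemma inv_simplicial_chain_group:
  assumes "c \<in> carrier (simplicial_chain_group \<Delta> i)"
  shows "inv\<^bsub>simplicial_chain_group \<Delta> i\<^esub> c = (\<lambda>\<sigma>. - c \<sigma>)"
proof -
  interpret comm_group "simplicial_chain_group \<Delta> i" by (rule comm_group_simplicial_chain_group)
  show ?thesis
    by (rule inv_equality) (use assms in \<open>auto simp: simplicial_chain_group_def\<close>)
qed

lemma subgroup_simplicial_cycles:
  "subgroup (simplicial_cycles \<Delta> i :: ('a::order set \<Rightarrow> 'k::field) set) (simplicial_chain_group \<Delta> i)"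
proof -
  interpret comm_group "simplicial_chain_group \<Delta> i :: ('a set \<Rightarrow> 'k) monoid"
    by (rule comm_group_simplicial_chain_group)
  have m: "c \<otimes>\<^bsub>simplicial_chain_group \<Delta> i\<^esub> d = (\<lambda>\<sigma>. c \<sigma> + d \<sigma>)" for c d :: "'a set \<Rightarrow> 'k"
    by (simp add: simplicial_chain_group_def)
  show ?thesis
  proof (rule subgroupI)
    have "(\<lambda>_. 0) \<in> (simplicial_cycles \<Delta> i :: ('a set \<Rightarrow> 'k) set)"
      by (auto simp: simplicial_cycles_def simplicial_chain_group_def simplicial_boundary_def)
    then show "(simplicial_cycles \<Delta> i :: ('a set \<Rightarrow> 'k) set) \<noteq> {}" by blast
  next
    fix c :: "'a set \<Rightarrow> 'k" assume c: "c \<in> simplicial_cycles \<Delta> i"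
    then have "inv\<^bsub>simplicial_chain_group \<Delta> i\<^esub> c \<in> carrier (simplicial_chain_group \<Delta> i)"
      by (auto simp: simplicial_cycles_def)
    with c show "inv\<^bsub>simplicial_chain_group \<Delta> i\<^esub> c \<in> simplicial_cycles \<Delta> i"
      by (auto simp: simplicial_cycles_def inv_simplicial_chain_group simplicial_boundary_uminus)
  next
    fix c d :: "'a set \<Rightarrow> 'k" assume cd: "c \<in> simplicial_cycles \<Delta> i" "d \<in> simplicial_cycles \<Delta> i"
    then have "c \<otimes>\<^bsub>simplicial_chain_group \<Delta> i\<^esub> d \<in> carrier (simplicial_chain_group \<Delta> i)"
      by (auto simp: simplicial_cycles_def)
    with cd show "c \<otimes>\<^bsub>simplicial_chain_group \<Delta> i\<^esub> d \<in> simplicial_cycles \<Delta> i"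
      by (auto simp: simplicial_cycles_def m simplicial_boundary_add)
  qed (auto simp: simplicial_cycles_def)
qed

lemma comm_group_poset_homology:
  assumes fin: "finite P"
  shows "comm_group (poset_homology i P :: ('a::order set \<Rightarrow> 'k::field) set monoid)"
proof -
  let ?D = "order_complex P"
  let ?C = "simplicial_chain_group ?D i :: ('a set \<Rightarrow> 'k) monoid"
  let ?C' = "simplicial_chain_group ?D (i + 1) :: ('a set \<Rightarrow> 'k) monoid"
  let ?Z = "?C\<lparr>carrier := simplicial_cycles ?D i\<rparr>"
  interpret C: comm_group ?C by (rule comm_group_simplicial_chain_group)
  interpret C': comm_group ?C' by (rule comm_group_simplicial_chain_group)
  interpret Z: comm_group ?Z
    by (rule group.group_comm_groupI[OF C.subgroup_imp_group[OF subgroup_simplicial_cycles]])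
       (simp add: simplicial_chain_group_def add.commute)
  have "simplicial_boundary ?D \<in> hom ?C' ?Z"
  proof (rule homI)
    fix c :: "'a set \<Rightarrow> 'k" assume "c \<in> carrier ?C'"
    then show "simplicial_boundary ?D c \<in> carrier ?Z"
      by (simp add: simplicial_cycles_def simplicial_boundary_boundary[OF fin]
          simplicial_boundary_in_carrier)
  qed (simp add: simplicial_chain_group_def simplicial_boundary_add)
  then interpret group_hom ?C' ?Z "simplicial_boundary ?D"
    by unfold_locales
  have "subgroup (simplicial_boundaries ?D i) ?Z"
    using img_is_subgroup by (simp add: simplicial_boundaries_def)
  then show ?thesis
    unfolding poset_homology_def by (rule Z.abelian_FactGroup)
qed

lemma poset_homology_empty:
  "\<not> trivial_group (poset_homology (-1) {} :: ('a::order set \<Rightarrow> 'k::field) set monoid)"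
proof
  let ?H = "poset_homology (-1) {} :: ('a set \<Rightarrow> 'k) set monoid"
  let ?u = "(\<lambda>\<sigma>. if \<sigma> = {} then 1 else 0) :: 'a set \<Rightarrow> 'k"
  have D: "order_complex ({} :: 'a set) = {{}}"
    by (auto simp: order_complex_def totalp_on_def)
  have b: "simplicial_boundary {{}} c = (\<lambda>_. 0)" for c :: "'a set \<Rightarrow> 'k"
    by (simp add: simplicial_boundary_def)
  have B: "simplicial_boundaries {{}} (-1) = {(\<lambda>_. 0) :: 'a set \<Rightarrow> 'k}"
    by (auto simp: simplicial_boundaries_def b simplicial_chain_group_def intro!: image_eqI)
  assume "trivial_group ?H"
  then have c: "carrier ?H = {\<one>\<^bsub>?H\<^esub>}" by (simp add: trivial_group_def)
  have "?u \<in> simplicial_cycles {{}} (-1)"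
    by (auto simp: simplicial_cycles_def b simplicial_chain_group_def)
  then have "{?u} \<in> carrier ?H"
    unfolding poset_homology_def carrier_FactGroup
    by (intro image_eqI[of _ _ ?u])
       (auto simp: D B r_coset_def simplicial_chain_group_def)
  then have "{?u} = {\<lambda>_. 0}" using c by (simp add: poset_homology_def D B)
  then have "?u = (\<lambda>_. 0)" by (rule singleton_inject)
  then have "?u {} = 0" by (rule fun_cong)
  then show False by simp
qed

end

theory Submission
  imports Defs
begin

text \<open>
  Cancelling pairs of chains in the order complex of \<open>L - {bot}\<close> gives a complex with a basis graded
  by \<open>L\<close>, whose boundary \<open>\<partial>\<close> strictly decreases the grade and whose basis elements of grade \<open>x\<close> and
  degree \<open>i\<close> exist iff \<open>x\<close> is an \<open>(i-1)\<close>-synor; the parts below any \<open>v \<noteq> bot\<close> are acyclic.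
  Let \<open>c\<close> be a basis element of grade \<open>top\<close> and degree \<open>n = i\<^sub>1 + i\<^sub>2 - k\<close>, and let \<open>c\<^sup>*\<close> be its
  coordinate function. Consider the basis pairs \<open>x \<otimes> v\<close> whose grades have join \<open>top\<close>. Acyclicity
  provides a product \<open>x v\<close> and a homotopy \<open>\<rho>\<close> between \<open>x \<otimes> v \<mapsto> c\<^sup>*(x) v\<close> and \<open>x \<otimes> v \<mapsto> c\<^sup>*(x v)\<close>.
  If there were no pairs in bidegree \<open>(i\<^sub>1, i\<^sub>2)\<close>, then \<open>\<rho>\<close> could be chosen to vanish for
  \<open>deg x \<le> i\<^sub>1\<close>, \<open>deg v \<ge> i\<^sub>2\<close>, and the traces of \<open>x \<mapsto> \<partial> \<rho>(x \<otimes> c)\<close> would be nonzero in all degrees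
  from \<open>n\<close> on.
\<close>

section \<open>Graded complexes\<close>

text \<open>Chains are functions on a whole finite type, with the matrix acting from the right.
  Cancellation can then shrink the basis \<open>B\<close> while the type stays fixed.\<close>

definition matrix_boundary :: "('b::finite \<Rightarrow> 'b \<Rightarrow> 'k::field) \<Rightarrow> ('b \<Rightarrow> 'k) \<Rightarrow> 'b \<Rightarrow> 'k" where
  "matrix_boundary D w = (\<lambda>t. \<Sum>b\<in>UNIV. w b * D b t)"

lemma matrix_boundary_sum:
  "matrix_boundary D (\<lambda>b. \<Sum>i\<in>I. a i * f i b) t = (\<Sum>i\<in>I. a i * matrix_boundary D (f i) t)"
  unfolding matrix_boundary_def sum_distrib_left sum_distrib_right
  by (subst sum.swap) (simp add: mult.assoc)

lemma matrix_boundary_add: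
  "matrix_boundary D (\<lambda>b. v b + w b) t = matrix_boundary D v t + matrix_boundary D w t"
  by (simp add: matrix_boundary_def algebra_simps sum.distrib)

lemma matrix_boundary_diff:
  "matrix_boundary D (\<lambda>b. v b - w b) t = matrix_boundary D v t - matrix_boundary D w t"
  by (simp add: matrix_boundary_def algebra_simps sum_subtractf)

lemma matrix_boundary_scale:
  "matrix_boundary D (\<lambda>b. a * w b) t = a * matrix_boundary D w t"
  by (simp add: matrix_boundary_def sum_distrib_left mult.assoc)

lemma matrix_boundary_zero: "matrix_boundary D (\<lambda>_. 0) t = 0"
  by (simp add: matrix_boundary_def)

lemma sum_single:
  fixes f :: "'b::finite \<Rightarrow> 'k::comm_monoid_add"
  assumes "\<And>x. x \<noteq> a \<Longrightarrow> f x = 0"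
  shows "sum f UNIV = f a"
  by (subst sum.remove[of _ a]) (auto simp: assms)

lemma matrix_boundary_single:
  "matrix_boundary D (\<lambda>b. if b = s then a else 0) t = a * D s t"
  unfolding matrix_boundary_def by (subst sum_single[of s]) auto

text \<open>\<open>D s t\<close> is the coefficient of \<open>t\<close> in the boundary of \<open>s\<close>.\<close>

locale graded_complex =
  fixes B :: "'b::finite set" and g :: "'b \<Rightarrow> 'a::order" and deg :: "'b \<Rightarrow> nat"
    and D :: "'b \<Rightarrow> 'b \<Rightarrow> 'k::field"
  assumes D_nz: "D s t \<noteq> 0 \<Longrightarrow> s \<in> B \<and> t \<in> B \<and> g t \<le> g s \<and> deg s = Suc (deg t)"
    and D_D: "(\<Sum>b\<in>UNIV. D s b * D b t) = 0"
begin

abbreviation bd :: "('b \<Rightarrow> 'k) \<Rightarrow> 'b \<Rightarrow> 'k" where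
  "bd \<equiv> matrix_boundary D"

text \<open>The degree is an integer because the homotopies below are shifted by
  \<open>- int n\<close>; in a negative degree only the zero chain exists.\<close>

definition graded_chains :: "'a set \<Rightarrow> int \<Rightarrow> ('b \<Rightarrow> 'k) set" where
  "graded_chains X p = {w. \<forall>b. w b \<noteq> 0 \<longrightarrow> b \<in> B \<and> g b \<in> X \<and> int (deg b) = p}"

definition acyclic_on :: "'a set \<Rightarrow> int \<Rightarrow> bool" where
  "acyclic_on X p \<longleftrightarrow> (\<forall>w\<in>graded_chains X p. (\<forall>t. bd w t = 0) \<longrightarrow>
     (\<exists>u\<in>graded_chains X (p + 1). \<forall>t. bd u t = w t))"

lemma bd_bd: "bd (bd w) t = 0"
proof -
  have "bd (bd w) t = (\<Sum>b\<in>UNIV. w b * matrix_boundary D (D b) t)"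
    using matrix_boundary_sum[of D w D UNIV t] by (simp add: matrix_boundary_def)
  then show ?thesis by (simp add: matrix_boundary_def D_D)
qed

lemma graded_chains_I: "(\<And>b. w b \<noteq> 0 \<Longrightarrow> b \<in> B \<and> g b \<in> X \<and> int (deg b) = p) \<Longrightarrow> w \<in> graded_chains X p"
  by (simp add: graded_chains_def)

lemma graded_chains_D: "w \<in> graded_chains X p \<Longrightarrow> w b \<noteq> 0 \<Longrightarrow> b \<in> B \<and> g b \<in> X \<and> int (deg b) = p"
  by (simp add: graded_chains_def)

lemma graded_chains_mono: "w \<in> graded_chains X p \<Longrightarrow> X \<subseteq> Y \<Longrightarrow> w \<in> graded_chains Y p"
  by (auto simp: graded_chains_def)

lemma graded_chains_add: "v \<in> graded_chains X p \<Longrightarrow> w \<in> graded_chains X p \<Longrightarrow> (\<lambda>b. v b + w b) \<in> graded_chains X p"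
  unfolding graded_chains_def by (auto) (metis add_0)+

lemma graded_chains_diff: "v \<in> graded_chains X p \<Longrightarrow> w \<in> graded_chains X p \<Longrightarrow> (\<lambda>b. v b - w b) \<in> graded_chains X p"
  unfolding graded_chains_def by (auto) (metis diff_zero)+

lemma graded_chains_scale: "w \<in> graded_chains X p \<Longrightarrow> (\<lambda>b. a * w b) \<in> graded_chains X p"
  unfolding graded_chains_def by auto

lemma graded_chains_sum:
  assumes "\<And>i. i \<in> I \<Longrightarrow> a i \<noteq> 0 \<Longrightarrow> f i \<in> graded_chains X p"
  shows "(\<lambda>b. \<Sum>i\<in>I. a i * f i b) \<in> graded_chains X p"
proof (rule graded_chains_I)
  fix b assume "(\<Sum>i\<in>I. a i * f i b) \<noteq> 0"
  then obtain i where i: "i \<in> I" "a i * f i b \<noteq> 0" by (meson sum.neutral)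
  then show "b \<in> B \<and> g b \<in> X \<and> int (deg b) = p"
    using assms[of i] graded_chains_D by fastforce
qed

lemma graded_chains_single: "s \<in> B \<Longrightarrow> g s \<in> X \<Longrightarrow> int (deg s) = p \<Longrightarrow> (\<lambda>b. if b = s then a else 0) \<in> graded_chains X p"
  by (auto simp: graded_chains_def)

lemma graded_chains_bd:
  assumes "w \<in> graded_chains X (p + 1)" and "\<forall>x\<in>X. \<forall>y\<le>x. y \<in> X"
  shows "bd w \<in> graded_chains X p"
proof (rule graded_chains_I)
  fix t assume "bd w t \<noteq> 0"
  then obtain s where s: "w s * D s t \<noteq> 0" unfolding matrix_boundary_def by (meson sum.neutral)
  with D_nz[of s t] graded_chains_D[OF assms(1), of s] show "t \<in> B \<and> g t \<in> X \<and> int (deg t) = p"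
    using assms(2) by auto
qed

lemma acyclic_onD:
  assumes "acyclic_on X p" "w \<in> graded_chains X p" "\<And>t. bd w t = 0"
  obtains u where "u \<in> graded_chains X (p + 1)" "\<And>t. bd u t = w t"
  using assms unfolding acyclic_on_def by blast

text \<open>
  Chain maps (\<open>\<kappa> = 0\<close>) and homotopies out of a based complex \<open>(T, \<Delta>)\<close> are constructed degree
  by degree, as in the acyclic models theorem. The unspecified scalar \<open>\<tau>\<close> stands for a sign.
\<close>

lemma lifting:
  fixes T :: "'t::finite set" and \<Delta> :: "'t \<Rightarrow> 't \<Rightarrow> 'k" and N :: "'t \<Rightarrow> nat" and s :: int
    and up :: "'t \<Rightarrow> 'a" and \<tau> :: 'k and \<kappa> \<rho>\<^sub>0 :: "'t \<Rightarrow> 'b \<Rightarrow> 'k"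
  assumes \<Delta>_nz: "\<And>t t'. \<Delta> t t' \<noteq> 0 \<Longrightarrow> t' \<in> T \<and> N t = Suc (N t') \<and> up t' \<le> up t"
    and \<Delta>_\<Delta>: "\<And>t t''. (\<Sum>t'\<in>UNIV. \<Delta> t t' * \<Delta> t' t'') = 0"
    and \<kappa>: "\<And>t. t \<in> T \<Longrightarrow> \<kappa> t \<in> graded_chains {..up t} (int (N t) + s)"
    and d\<kappa>: "\<And>t b. t \<in> T \<Longrightarrow> bd (\<kappa> t) b = - \<tau> * (\<Sum>t'\<in>UNIV. \<Delta> t t' * \<kappa> t' b)"
    and S: "S \<subseteq> T" "\<And>t t'. t \<in> S \<Longrightarrow> \<Delta> t t' \<noteq> 0 \<Longrightarrow> t' \<in> S"
    and \<rho>\<^sub>0: "\<And>t. t \<in> S \<Longrightarrow> \<rho>\<^sub>0 t \<in> graded_chains {..up t} (int (N t) + s + 1)"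
    and d\<rho>\<^sub>0: "\<And>t b. t \<in> S \<Longrightarrow> bd (\<rho>\<^sub>0 t) b = \<kappa> t b + \<tau> * (\<Sum>t'\<in>UNIV. \<Delta> t t' * \<rho>\<^sub>0 t' b)"
    and acyc: "\<And>t p. t \<in> T \<Longrightarrow> t \<notin> S \<Longrightarrow> acyclic_on {..up t} p"
  shows "\<exists>\<rho>. (\<forall>t\<in>T. \<rho> t \<in> graded_chains {..up t} (int (N t) + s + 1) \<and>
               (\<forall>b. bd (\<rho> t) b = \<kappa> t b + \<tau> * (\<Sum>t'\<in>UNIV. \<Delta> t t' * \<rho> t' b))) \<and>
             (\<forall>t\<in>S. \<rho> t = \<rho>\<^sub>0 t)"
proof -
  define good where "good \<rho> t \<longleftrightarrow> \<rho> t \<in> graded_chains {..up t} (int (N t) + s + 1) \<and>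
      (\<forall>b. bd (\<rho> t) b = \<kappa> t b + \<tau> * (\<Sum>t'\<in>UNIV. \<Delta> t t' * \<rho> t' b))" for \<rho> t
  have "\<exists>\<rho>. (\<forall>t\<in>T. N t < m \<longrightarrow> good \<rho> t) \<and> (\<forall>t\<in>S. \<rho> t = \<rho>\<^sub>0 t)" for m
  proof (induction m)
    case 0
    show ?case by auto
  next
    case (Suc m)
    then obtain \<rho> where good: "\<And>t. t \<in> T \<Longrightarrow> N t < m \<Longrightarrow> good \<rho> t" and \<rho>S: "\<And>t. t \<in> S \<Longrightarrow> \<rho> t = \<rho>\<^sub>0 t"
      by blast
    define next_step where "next_step t u \<longleftrightarrow> u \<in> graded_chains {..up t} (int (N t) + s + 1) \<and>
       (\<forall>b. bd u b = \<kappa> t b + \<tau> * (\<Sum>t'\<in>UNIV. \<Delta> t t' * \<rho> t' b)) \<and> (t \<in> S \<longrightarrow> u = \<rho>\<^sub>0 t)" for t u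
    have "\<exists>u. next_step t u"
      if t: "t \<in> T" "N t = m" for t
    proof (cases "t \<in> S")
      case True
      have "\<Delta> t t' * \<rho> t' b = \<Delta> t t' * \<rho>\<^sub>0 t' b" for t' b
        using \<rho>S[OF S(2)[OF True, of t']] by (cases "\<Delta> t t' = 0") auto
      then have "(\<Sum>t'\<in>UNIV. \<Delta> t t' * \<rho> t' b) = (\<Sum>t'\<in>UNIV. \<Delta> t t' * \<rho>\<^sub>0 t' b)" for b
        by (intro sum.cong) auto
      then show ?thesis
        using \<rho>\<^sub>0[OF True] d\<rho>\<^sub>0[OF True] by (intro exI[of _ "\<rho>\<^sub>0 t"]) (simp add: next_step_def)
    next
      case False
      define w where "w = (\<lambda>b. \<kappa> t b + \<tau> * (\<Sum>t'\<in>UNIV. \<Delta> t t' * \<rho> t' b))"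
      have good': "good \<rho> t'" if "\<Delta> t t' \<noteq> 0" for t'
        using good[of t'] \<Delta>_nz[OF that] t by auto
      have "\<rho> t' \<in> graded_chains {..up t} (int (N t) + s)" if "\<Delta> t t' \<noteq> 0" for t'
        using good'[OF that] \<Delta>_nz[OF that] graded_chains_mono[of "\<rho> t'" "{..up t'}" _ "{..up t}"]
        unfolding good_def by (auto simp: algebra_simps)
      then have w: "w \<in> graded_chains {..up t} (int (N t) + s)"
        unfolding w_def by (intro graded_chains_add \<kappa> t graded_chains_scale graded_chains_sum) auto
      \<comment> \<open>The prescribed boundary \<open>w\<close> is a cycle: the
        \<open>\<kappa>\<close> terms cancel by \<open>d\<kappa>\<close>, and the remaining term
        contains the square of \<open>\<Delta>\<close>.\<close>
      have "bd w b = 0" for b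
      proof -
        have "(\<Sum>t'\<in>UNIV. \<Delta> t t' * bd (\<rho> t') b)
            = (\<Sum>t'\<in>UNIV. \<Delta> t t' * (\<kappa> t' b + \<tau> * (\<Sum>t''\<in>UNIV. \<Delta> t' t'' * \<rho> t'' b)))"
        proof (rule sum.cong[OF refl])
          fix t'
          show "\<Delta> t t' * bd (\<rho> t') b = \<Delta> t t' * (\<kappa> t' b + \<tau> * (\<Sum>t''\<in>UNIV. \<Delta> t' t'' * \<rho> t'' b))"
            using good'[of t'] unfolding good_def by (cases "\<Delta> t t' = 0") auto
        qed
        also have "\<dots> = (\<Sum>t'\<in>UNIV. \<Delta> t t' * \<kappa> t' b)
            + \<tau> * (\<Sum>t'\<in>UNIV. \<Sum>t''\<in>UNIV. \<Delta> t t' * \<Delta> t' t'' * \<rho> t'' b)"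
          by (simp add: distrib_left sum.distrib sum_distrib_left mult_ac)
        also have "(\<Sum>t'\<in>UNIV. \<Sum>t''\<in>UNIV. \<Delta> t t' * \<Delta> t' t'' * \<rho> t'' b) = 0"
          by (subst sum.swap) (simp add: sum_distrib_right[symmetric] \<Delta>_\<Delta>)
        finally have "(\<Sum>t'\<in>UNIV. \<Delta> t t' * bd (\<rho> t') b) = (\<Sum>t'\<in>UNIV. \<Delta> t t' * \<kappa> t' b)"
          by simp
        then show ?thesis
          unfolding w_def matrix_boundary_add matrix_boundary_scale matrix_boundary_sum
          by (simp add: d\<kappa>[OF t(1)])
      qed
      from acyclic_onD[OF acyc[OF t(1) False] w this]
      obtain u where "u \<in> graded_chains {..up t} (int (N t) + s + 1)" "\<And>b. bd u b = w b"
        by blast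
      then show ?thesis
        using False unfolding w_def by (intro exI[of _ u]) (simp add: next_step_def)
    qed
    then have "\<forall>t\<in>{t \<in> T. N t = m}. \<exists>u. next_step t u" by blast
    from bchoice[OF this] obtain u where u: "\<And>t. t \<in> T \<Longrightarrow> N t = m \<Longrightarrow> next_step t (u t)" by blast
    \<comment> \<open>Only values in degree \<open>m\<close> change, while the equations in degrees
      up to \<open>m\<close> use values of \<open>\<rho>\<close> on their right-hand sides in
      degrees below \<open>m\<close> only.\<close>
    define \<rho>' where "\<rho>' t = (if t \<in> T \<and> N t = m then u t else \<rho> t)" for t
    have eq: "\<Delta> t t' * \<rho>' t' b = \<Delta> t t' * \<rho> t' b" if "N t \<le> m" for t t' b
      using \<Delta>_nz[of t t'] that by (cases "\<Delta> t t' = 0") (auto simp: \<rho>'_def)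
    have "good \<rho>' t" if "t \<in> T" "N t < Suc m" for t
    proof (cases "N t = m")
      case True
      then show ?thesis using u[OF that(1) True] that by (simp add: good_def eq next_step_def) (simp add: \<rho>'_def)
    next
      case False
      then show ?thesis using good[of t] that by (simp add: good_def eq) (simp add: \<rho>'_def)
    qed
    moreover have "\<rho>' t = \<rho>\<^sub>0 t" if "t \<in> S" for t
      using u[of t] \<rho>S[OF that] that S(1) by (auto simp: \<rho>'_def next_step_def)
    ultimately show ?case by blast
  qed
  from this[of "Suc (Max (range N))"] show ?thesis
    unfolding good_def by (auto simp: less_Suc_eq_le)
qed

end

section \<open>Products and the trace argument\<close>

text \<open>The tensor product of the complex with itself. With the sign on the first factor,
  \<open>x \<otimes> v \<mapsto> c\<^sup>*(x) v\<close> commutes with boundaries without signs when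
  \<open>c\<^sup>*\<close> is a cocycle.\<close>

definition tensor_boundary ::
    "('b \<Rightarrow> nat) \<Rightarrow> ('b \<Rightarrow> 'b \<Rightarrow> 'k::field) \<Rightarrow> 'b \<times> 'b \<Rightarrow> 'b \<times> 'b \<Rightarrow> 'k" where
  "tensor_boundary deg D t t' =
     (if snd t = snd t' then (-1) ^ deg (snd t) * D (fst t) (fst t') else 0) +
     (if fst t = fst t' then D (snd t) (snd t') else 0)"

lemma sum_pairs:
  fixes f :: "'b::finite \<times> 'b \<Rightarrow> 'k::comm_monoid_add"
  shows "sum f UNIV = (\<Sum>x\<in>UNIV. \<Sum>y\<in>UNIV. f (x, y))"
  by (simp add: sum.cartesian_product flip: UNIV_Times_UNIV)

lemma sum_tensor_boundary:
  fixes D :: "'b::finite \<Rightarrow> 'b \<Rightarrow> 'k::field"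
  shows "(\<Sum>t\<in>UNIV. tensor_boundary deg D (x, v) t * f t) =
    (-1) ^ deg v * (\<Sum>x'\<in>UNIV. D x x' * f (x', v)) + (\<Sum>v'\<in>UNIV. D v v' * f (x, v'))"
proof -
  have 1: "(\<Sum>v'\<in>UNIV. (if v = v' then a else 0) * f (x', v')) = a * f (x', v)" for x' a
    by (subst sum_single[of v]) auto
  have 2: "(\<Sum>x'\<in>UNIV. \<Sum>v'\<in>UNIV. (if x = x' then D v v' else 0) * f (x', v'))
      = (\<Sum>v'\<in>UNIV. D v v' * f (x, v'))"
    by (subst sum_single[of x]) auto
  show ?thesis
    unfolding sum_pairs tensor_boundary_def fst_conv snd_conv distrib_right sum.distrib 1 2
    by (simp add: sum_distrib_left mult.assoc)
qed

context graded_complex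
begin

lemma tensor_boundary_nz:
  assumes "tensor_boundary deg D (x, v) (x', v') \<noteq> 0"
  obtains "x \<in> B" "x' \<in> B" "v = v'" "D x x' \<noteq> 0" "deg x = Suc (deg x')" "g x' \<le> g x"
  | "v \<in> B" "v' \<in> B" "x = x'" "D v v' \<noteq> 0" "deg v = Suc (deg v')" "g v' \<le> g v"
proof (cases "v = v' \<and> D x x' \<noteq> 0")
  case True
  with D_nz[of x x'] that(1) show ?thesis by blast
next
  case False
  with assms have "x = x'" "D v v' \<noteq> 0" by (auto simp: tensor_boundary_def split: if_splits)
  with D_nz[of v v'] that(2) show ?thesis by blast
qed

lemma tensor_boundary_boundary:
  "(\<Sum>t'\<in>UNIV. tensor_boundary deg D t t' * tensor_boundary deg D t' t'') = 0"
proof -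
  obtain x v where t: "t = (x, v)" by force
  obtain x'' v'' where t'': "t'' = (x'', v'')" by force
  have [simp]: "(\<Sum>x'\<in>UNIV. D x x' * (if x' = x'' then c else 0)) = D x x'' * c" for x x'' c
    by (subst sum_single[of x'']) auto
  \<comment> \<open>The two mixed paths, lowering \<open>x\<close> first or \<open>v\<close> first,
    have opposite signs because \<open>D\<close> lowers the degree of \<open>v\<close> by
    one.\<close>
  have "(-1) ^ deg v * D v v'' + (-1) ^ deg v'' * D v v'' = 0"
    using D_nz[of v v''] by (cases "D v v'' = 0") auto
  then have "D x x'' * ((-1) ^ deg v * D v v'' + (-1) ^ deg v'' * D v v'') = 0" by simp
  then have "(-1) ^ deg v * (D x x'' * D v v'') + D v v'' * ((-1) ^ deg v'' * D x x'') = 0"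
    by (simp only: distrib_left mult_ac)
  moreover have "(\<Sum>x'\<in>UNIV. D x x' * (e * D x' x'')) = e * (\<Sum>x'\<in>UNIV. D x x' * D x' x'')" for e
    by (simp add: sum_distrib_left mult_ac)
  then have "(\<Sum>x'\<in>UNIV. D x x' * (if v = v'' then (-1) ^ deg v * D x' x'' else 0)) = 0"
    by (cases "v = v''") (simp_all add: D_D)
  moreover have "(\<Sum>v'\<in>UNIV. D v v' * (if x = x'' then D v' v'' else 0)) = 0"
    using D_D[of v v''] by (cases "x = x''") simp_all
  moreover have "(\<Sum>v'\<in>UNIV. D v v' * (if v' = v'' then (-1) ^ deg v' * D x x'' else 0))
     = D v v'' * ((-1) ^ deg v'' * D x x'')"
    by (subst sum_single[of v'']) auto
  ultimately show ?thesis
    unfolding t t'' sum_tensor_boundary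
    unfolding tensor_boundary_def fst_conv snd_conv distrib_left sum.distrib
    by simp
qed

end

text \<open>A first-order linear recurrence that starts from zero after \<open>a\<close>: it stays
  zero until the unit input at \<open>n\<close>, and each later step multiplies by
  \<open>\<theta>\<close>.\<close>

lemma impulse_response:
  fixes A :: "nat \<Rightarrow> 'k::field"
  assumes an: "a < n"
    and A: "\<And>p. a < p \<Longrightarrow> A p = (if p = n then 1 else 0) + \<theta> * (if p = Suc a then 0 else A (p - 1))"
  shows "A (n + j) = \<theta> ^ j"
proof -
  have A0: "A p = 0" if "a < p" "p < n" for p
    using that
  proof (induction p)
    case (Suc p)
    then show ?case using A[of "Suc p"] by (cases "p = a") simp_all
  qed simp
  show ?thesis
  proof (induction j)
    case 0
    have "n = Suc a \<or> a < n - 1" using an by linarith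
    then have "n = Suc a \<or> A (n - 1) = 0" using A0[of "n - 1"] by auto
    then show ?case using A[of n] an by auto
  next
    case (Suc j)
    have "A (n + Suc j) = \<theta> * A (n + j)" using A[of "n + Suc j"] an by simp
    with Suc show ?case by simp
  qed
qed

text \<open>\<open>z\<close> is the empty simplex: degrees are those of simplices shifted by one.\<close>

locale minimal_resolution =
  graded_complex B g deg D
  for B :: "'b::finite set" and g :: "'b \<Rightarrow> 'a::bounded_lattice" and deg :: "'b \<Rightarrow> nat"
    and D :: "'b \<Rightarrow> 'b \<Rightarrow> 'k::field" +
  fixes z :: 'b
  assumes D_strict: "D s t \<noteq> 0 \<Longrightarrow> g t < g s"
    and acyclic_atMost: "v \<noteq> bot \<Longrightarrow> acyclic_on {..v} p"
    and z_in: "z \<in> B" and deg_z: "deg z = 0" and g_z: "g z = bot"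
    and g_eq_bot: "b \<in> B \<Longrightarrow> g b = bot \<Longrightarrow> b = z"
begin

section \<open>Products on a minimal resolution\<close>

lemma D_from_z: "D z t = 0"
  using D_nz[of z t] deg_z by auto

text \<open>Lifting with \<open>\<kappa> = 0\<close> on the tensor complex. Products with the right
  unit \<open>z\<close> are prescribed; every other second factor \<open>y\<close> has
  \<open>g y \<noteq> bot\<close>, so the chains below the join are acyclic.\<close>

lemma exists_multiplication:
  "\<exists>M. \<forall>x\<in>B. \<forall>y\<in>B. M (x, y) \<in> graded_chains {..sup (g x) (g y)} (int (deg x + deg y)) \<and>
      (\<forall>b. bd (M (x, y)) b = (\<Sum>t\<in>UNIV. tensor_boundary deg D (x, y) t * M t b)) \<and>
      M (x, z) = (\<lambda>b. if b = x then 1 else 0)"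
proof -
  define \<Delta> where "\<Delta> t t' = (if t \<in> B \<times> B then tensor_boundary deg D t t' else 0)" for t t'
  have nz: "t' \<in> B \<times> B \<and> deg (fst t) + deg (snd t) = Suc (deg (fst t') + deg (snd t')) \<and>
      sup (g (fst t')) (g (snd t')) \<le> sup (g (fst t)) (g (snd t))" if "\<Delta> t t' \<noteq> 0" for t t'
  proof -
    obtain x v x' v' where t: "t = (x, v)" "t' = (x', v')" by force
    from that have "tensor_boundary deg D (x, v) (x', v') \<noteq> 0" "x \<in> B" "v \<in> B"
      by (auto simp: \<Delta>_def t split: if_splits)
    then show ?thesis
      by (elim tensor_boundary_nz) (auto simp: t intro: le_supI1 le_supI2)
  qed
  have sq: "(\<Sum>t'\<in>UNIV. \<Delta> t t' * \<Delta> t' t'') = 0" for t t''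
  proof (cases "t \<in> B \<times> B")
    case True
    have "\<Delta> t t' * \<Delta> t' t'' = tensor_boundary deg D t t' * tensor_boundary deg D t' t''" for t'
      using nz[of t t'] True by (cases "\<Delta> t t' = 0") (auto simp: \<Delta>_def)
    then show ?thesis by (simp add: tensor_boundary_boundary)
  qed (simp add: \<Delta>_def)
  have S_closed: "t' \<in> B \<times> {z}" if "t \<in> B \<times> {z}" "\<Delta> t t' \<noteq> 0" for t t'
    using nz[OF that(2)] that by (auto simp: \<Delta>_def tensor_boundary_def D_from_z split: if_splits)
  \<comment> \<open>The shift \<open>- 1\<close> makes \<open>M\<close> preserve degrees, and the
    scalar \<open>1\<close> makes it a chain map.\<close>
  have "\<exists>M. (\<forall>t\<in>B \<times> B. M t \<in> graded_chains {..sup (g (fst t)) (g (snd t))}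
               (int (deg (fst t) + deg (snd t)) + - 1 + 1) \<and>
               (\<forall>b. bd (M t) b = 0 + 1 * (\<Sum>t'\<in>UNIV. \<Delta> t t' * M t' b))) \<and>
             (\<forall>t\<in>B \<times> {z}. M t = (\<lambda>b. if b = fst t then 1 else 0))"
  proof (rule lifting)
    fix t b assume t: "t \<in> B \<times> {z}"
    have "(\<Sum>t'\<in>UNIV. \<Delta> t t' * (if b = fst t' then 1 else 0)) = D (fst t) b"
    proof -
      obtain x where x: "t = (x, z)" "x \<in> B" using t by auto
      have "(\<Sum>x'\<in>UNIV. D x x' * (if b = x' then 1 else 0)) = D x b"
        by (subst sum_single[of b]) auto
      then show ?thesis
        using x z_in by (simp add: \<Delta>_def sum_tensor_boundary deg_z D_from_z)
    qed
    then show "bd (\<lambda>b. if b = fst t then 1 else 0) b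
        = 0 + 1 * (\<Sum>t'\<in>UNIV. \<Delta> t t' * (if b = fst t' then 1 else 0))"
      by (simp add: matrix_boundary_single)
  next
    fix t assume "t \<in> B \<times> {z}"
    then show "(\<lambda>b. if b = fst t then 1 else 0) \<in> graded_chains {..sup (g (fst t)) (g (snd t))}
               (int (deg (fst t) + deg (snd t)) + - 1 + 1)"
      by (intro graded_chains_single) (auto simp: deg_z)
  next
    fix t p assume "t \<in> B \<times> B" "t \<notin> B \<times> {z}"
    then have "snd t \<in> B" "snd t \<noteq> z" by auto
    then have "g (snd t) \<noteq> bot" using g_eq_bot by blast
    then show "acyclic_on {..sup (g (fst t)) (g (snd t))} p"
      by (intro acyclic_atMost) (metis bot.extremum_uniqueI sup.cobounded2)
  next
    fix t t' assume "\<Delta> t t' \<noteq> 0"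
    from nz[OF this] show "t' \<in> B \<times> B \<and> deg (fst t) + deg (snd t) = Suc (deg (fst t') + deg (snd t')) \<and>
      sup (g (fst t')) (g (snd t')) \<le> sup (g (fst t)) (g (snd t))" .
  next
    fix t t' assume "t \<in> B \<times> {z}" "\<Delta> t t' \<noteq> 0"
    then show "t' \<in> B \<times> {z}" by (rule S_closed)
  qed (use z_in in \<open>auto simp: sq matrix_boundary_zero graded_chains_def\<close>)
  then obtain M where M: "\<forall>t\<in>B \<times> B. M t \<in> graded_chains {..sup (g (fst t)) (g (snd t))}
               (int (deg (fst t) + deg (snd t)) + - 1 + 1) \<and>
               (\<forall>b. bd (M t) b = 0 + 1 * (\<Sum>t'\<in>UNIV. \<Delta> t t' * M t' b))"
      "\<forall>t\<in>B \<times> {z}. M t = (\<lambda>b. if b = fst t then 1 else 0)"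
    by blast
  show ?thesis
  proof (intro exI[of _ M] ballI conjI allI)
    fix x y b assume xy: "x \<in> B" "y \<in> B"
    show "M (x, y) \<in> graded_chains {..sup (g x) (g y)} (int (deg x + deg y))"
      using bspec[OF M(1), of "(x, y)"] xy by simp
    show "bd (M (x, y)) b = (\<Sum>t\<in>UNIV. tensor_boundary deg D (x, y) t * M t b)"
      using bspec[OF M(1), of "(x, y)"] xy by (simp add: \<Delta>_def)
    show "M (x, z) = (\<lambda>b. if b = x then 1 else 0)"
      using bspec[OF M(2), of "(x, z)"] xy by simp
  qed
qed

text \<open>
  The set \<open>T\<close> omits the pairs on which \<open>\<rho>\<close> is to vanish. It carries a complex because the differential
  can only leave and reenter \<open>T\<close> through bidegree \<open>(a, b)\<close>. For \<open>p > a\<close> the traces \<open>A p\<close> of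
  \<open>x \<mapsto> \<partial> \<rho>(x \<otimes> c)\<close> in degree \<open>p\<close> satisfy \<open>A p = [p = n] \<plusminus> A (p - 1)\<close>, where the last term is
  dropped for \<open>p = a + 1\<close>: the contributions of \<open>x \<otimes> \<partial> c\<close> vanish, since \<open>\<rho>(x \<otimes> v)\<close> has grade at most \<open>g v\<close>.
\<close>

lemma exists_pair_top_aux:
  assumes c: "c \<in> B" "g c = top_class.top" "deg c = n" and ab: "a < n" "b \<le> n" "n \<le> a + b"
  shows "\<exists>x\<in>B. \<exists>y\<in>B. deg x = a \<and> deg y = b \<and> sup (g x) (g y) = top_class.top"
proof (rule ccontr)
  assume "\<not> ?thesis"
  then have no: "\<And>x y. x \<in> B \<Longrightarrow> y \<in> B \<Longrightarrow> deg x = a \<Longrightarrow> deg y = b \<Longrightarrow> sup (g x) (g y) \<noteq> top_class.top"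
    by blast
  obtain M where
    M: "\<And>x y. x \<in> B \<Longrightarrow> y \<in> B \<Longrightarrow> M (x, y) \<in> graded_chains {..sup (g x) (g y)} (int (deg x + deg y))"
    and dM: "\<And>x y b. x \<in> B \<Longrightarrow> y \<in> B \<Longrightarrow>
        bd (M (x, y)) b = (\<Sum>t\<in>UNIV. tensor_boundary deg D (x, y) t * M t b)"
    and M_z: "\<And>x. x \<in> B \<Longrightarrow> M (x, z) = (\<lambda>b. if b = x then 1 else 0)"
    using exists_multiplication by blast
  \<comment> \<open>Pairs with \<open>v = z\<close> are omitted too: since \<open>z\<close> is a
    unit, \<open>\<kappa>\<close> below vanishes on them, and for the remaining pairs
    \<open>{..g v}\<close> is acyclic.\<close>
  define T where "T = {(x, v). x \<in> B \<and> v \<in> B \<and> sup (g x) (g v) = top_class.top \<and> v \<noteq> z \<and> (deg v < b \<or> a < deg x)}"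
  define \<Delta> where "\<Delta> t t' = (if t \<in> T \<and> t' \<in> T then tensor_boundary deg D t t' else 0)" for t t'
  \<comment> \<open>The difference of the two chain maps that \<open>\<rho>\<close> joins,
    \<open>x \<otimes> v \<mapsto> c\<^sup>*(x) v\<close> and
    \<open>x \<otimes> v \<mapsto> c\<^sup>*(x v) z\<close>. Both have values of grade at most
    \<open>g v\<close>, as \<open>g z = bot\<close>.\<close>
  define \<kappa> where "\<kappa> = (\<lambda>(x, v) y. (if x = c \<and> y = v then 1 else 0) - (if y = z then M (x, v) c else 0))"

  \<comment> \<open>Boundaries strictly lower the grade and \<open>c\<close> has the greatest one,
    so the coordinate of \<open>c\<close> is a cocycle.\<close>
  have D_c: "D x c = 0" for x
    using D_strict[of x c] c(2) by (auto simp: less_le_not_le)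
  have M_c: "deg x + deg v = n \<and> sup (g x) (g v) = top_class.top" if "M (x, v) c \<noteq> 0" "x \<in> B" "v \<in> B" for x v
    using graded_chains_D[OF M[OF that(2,3)] that(1)] c by (auto simp: top_unique)

  have sq: "(\<Sum>t'\<in>UNIV. \<Delta> t t' * \<Delta> t' t'') = 0" for t t''
  proof (cases "t \<in> T \<and> t'' \<in> T")
    case True
    obtain x v x'' v'' where t: "t = (x, v)" "t'' = (x'', v'')" by force
    have "\<Delta> t t' * \<Delta> t' t'' = tensor_boundary deg D t t' * tensor_boundary deg D t' t''" for t'
    proof (cases "t' \<in> T \<or> tensor_boundary deg D t t' = 0 \<or> tensor_boundary deg D t' t'' = 0")
      case False
      obtain x' v' where t': "t' = (x', v')" by force
      have 1: "tensor_boundary deg D (x, v) (x', v') \<noteq> 0" and 2: "tensor_boundary deg D (x', v') (x'', v'') \<noteq> 0"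
        using False by (auto simp: t t')
      have B': "x \<in> B" "v \<in> B" "x'' \<in> B" "v'' \<in> B" "sup (g x'') (g v'') = top_class.top" "v'' \<noteq> z"
          "deg v < b \<or> a < deg x" "deg v'' < b \<or> a < deg x''"
        using True by (auto simp: T_def t)
      have B1: "x' \<in> B" "v' \<in> B" using 1 B' by (auto elim!: tensor_boundary_nz)
      have B2: "sup (g x'') (g v'') \<le> sup (g x') (g v')"
        using 2 by (auto elim!: tensor_boundary_nz intro: le_supI1 le_supI2)
      have B3: "v' \<noteq> z" using 2 B' by (auto elim!: tensor_boundary_nz simp: D_from_z)
      from B2 B' have B4: "sup (g x') (g v') = top_class.top" by (simp add: top_unique)
      from False B1 B3 B4 have "\<not> deg v' < b" "\<not> a < deg x'" by (auto simp: T_def t')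
      \<comment> \<open>The step out of \<open>T\<close> must lower the first degree from
        \<open>a + 1\<close>, and the step back into \<open>T\<close> must lower the second degree
        from \<open>b\<close>.\<close>
      moreover have "deg x' = a" "deg v' = b"
        using 1 2 B' calculation by (auto elim!: tensor_boundary_nz)
      ultimately show ?thesis using no[OF B1] B4 by blast
    qed (use True in \<open>auto simp: \<Delta>_def\<close>)
    then show ?thesis by (simp add: tensor_boundary_boundary)
  qed (auto simp: \<Delta>_def)

  have \<kappa>_chain: "\<kappa> t \<in> graded_chains {..g (snd t)} (int (deg (fst t) + deg (snd t)) - int n)"
    if "t \<in> T" for t
  proof (rule graded_chains_I)
    fix y assume nz: "\<kappa> t y \<noteq> 0"
    obtain x v where t: "t = (x, v)" by force
    have B: "x \<in> B" "v \<in> B" using that by (auto simp: T_def t)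
    from nz have "x = c \<and> y = v \<or> y = z \<and> M (x, v) c \<noteq> 0"
      by (auto simp: \<kappa>_def t split: if_splits)
    then show "y \<in> B \<and> g y \<in> {..g (snd t)} \<and> int (deg y) = int (deg (fst t) + deg (snd t)) - int n"
      using M_c[OF _ B] B c z_in by (auto simp: t g_z deg_z)
  qed

  have d\<kappa>: "bd (\<kappa> t) y = - (- 1) * (\<Sum>t'\<in>UNIV. \<Delta> t t' * \<kappa> t' y)" if tT: "t \<in> T" for t y
  proof -
    obtain x v where t: "t = (x, v)" by force
    have B: "x \<in> B" "v \<in> B" "deg v < b \<or> a < deg x" "v \<noteq> z" using that by (auto simp: T_def t)
    \<comment> \<open>\<open>\<kappa>\<close> is a chain map for the full tensor boundary; it
      remains one on \<open>T\<close> because the pairs dropped by \<open>\<Delta>\<close>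
      contribute nothing.\<close>
    have "(\<Sum>t'\<in>UNIV. \<Delta> t t' * \<kappa> t' y) = (\<Sum>t'\<in>UNIV. tensor_boundary deg D t t' * \<kappa> t' y)"
    proof (rule sum.cong[OF refl])
      fix t' :: "'b \<times> 'b"
      obtain x' v' where t': "t' = (x', v')" by force
      show "\<Delta> t t' * \<kappa> t' y = tensor_boundary deg D t t' * \<kappa> t' y"
      proof (cases "t' \<in> T \<or> tensor_boundary deg D t t' = 0 \<or> \<kappa> t' y = 0")
        case False
        have 1: "tensor_boundary deg D (x, v) (x', v') \<noteq> 0" using False by (auto simp: t t')
        have B1: "x' \<in> B" "v' \<in> B" using 1 B by (auto elim!: tensor_boundary_nz)
        from False have "x' = c \<and> y = v' \<or> y = z \<and> M (x', v') c \<noteq> 0"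
          by (auto simp: \<kappa>_def t' split: if_splits)
        then have B2: "sup (g x') (g v') = top_class.top" and B3: "x' = c \<or> deg x' + deg v' = n"
          using M_c[OF _ B1] c by auto
        have B4: "v' \<noteq> z"
          using False B1 M_z[OF B1(1)] by (auto simp: \<kappa>_def t' split: if_splits)
        from False B1 B2 B4 have nlt: "\<not> deg v' < b" "\<not> a < deg x'" by (auto simp: T_def t')
        moreover have "deg x' = a \<or> deg v < b"
          using 1 B(3) nlt by (auto elim!: tensor_boundary_nz)
        moreover have "deg v' \<le> deg v" using 1 by (auto elim!: tensor_boundary_nz)
        \<comment> \<open>\<open>a < n\<close> excludes \<open>x' = c\<close>, so the degrees of the
          pair add up to \<open>n \<le> a + b\<close>; with \<open>deg x' = a\<close> this bounds
          \<open>deg v'\<close> by \<open>b\<close>.\<close>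
        ultimately have "deg x' = a" "deg v' = b" using B3 c ab by auto
        with no[OF B1] B2 show ?thesis by blast
      qed (use tT in \<open>auto simp: \<Delta>_def\<close>)
    qed
    also have "\<dots> = (\<Sum>t'\<in>UNIV. tensor_boundary deg D t t' * (if fst t' = c \<and> y = snd t' then 1 else 0))
       - (if y = z then \<Sum>t'\<in>UNIV. tensor_boundary deg D t t' * M t' c else 0)"
      by (simp add: \<kappa>_def case_prod_unfold right_diff_distrib sum_subtractf)
    also have "(\<Sum>t'\<in>UNIV. tensor_boundary deg D t t' * M t' c) = bd (M (x, v)) c"
      using dM[OF B(1,2)] by (simp add: t)
    also have "bd (M (x, v)) c = 0" by (simp add: matrix_boundary_def D_c)
    also have "(\<Sum>t'\<in>UNIV. tensor_boundary deg D t t' * (if fst t' = c \<and> y = snd t' then 1 else 0))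
       = (if x = c then D v y else 0)"
    proof -
      have "(\<Sum>x'\<in>UNIV. D x x' * (if x' = c \<and> y = v then 1 else 0)) = 0"
        by (intro sum.neutral) (auto simp: D_c)
      moreover have "(\<Sum>v'\<in>UNIV. D v v' * (if x = c \<and> y = v' then 1 else 0)) = (if x = c then D v y else 0)"
        by (subst sum_single[of y]) auto
      ultimately show ?thesis by (simp add: t sum_tensor_boundary)
    qed
    finally have 1: "(\<Sum>t'\<in>UNIV. \<Delta> t t' * \<kappa> t' y) = (if x = c then D v y else 0)" by simp
    have "\<kappa> t = (\<lambda>y. (if y = v then if x = c then 1 else 0 else 0) - (if y = z then M (x, v) c else 0))"
      by (auto simp: \<kappa>_def t fun_eq_iff)
    then have "bd (\<kappa> t) y = (if x = c then D v y else 0)"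
      by (simp add: matrix_boundary_diff matrix_boundary_single D_from_z)
    with 1 show ?thesis by simp
  qed

  \<comment> \<open>With the scalar \<open>- 1\<close> and the shift \<open>- int n\<close>, lifting
    gives a null-homotopy of \<open>\<kappa>\<close> on \<open>T\<close>.\<close>
  have "\<exists>\<rho>. (\<forall>t\<in>T. \<rho> t \<in> graded_chains {..g (snd t)} (int (deg (fst t) + deg (snd t)) + - int n + 1) \<and>
               (\<forall>y. bd (\<rho> t) y = \<kappa> t y + - 1 * (\<Sum>t'\<in>UNIV. \<Delta> t t' * \<rho> t' y))) \<and>
             (\<forall>t\<in>{}. \<rho> t = (\<lambda>_. 0))"
  proof (rule lifting)
    fix t t' assume nz: "\<Delta> t t' \<noteq> 0"
    obtain x v x' v' where t: "t = (x, v)" "t' = (x', v')" by force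
    from nz have "t' \<in> T" "tensor_boundary deg D (x, v) (x', v') \<noteq> 0"
      by (auto simp: \<Delta>_def t split: if_splits)
    then show "t' \<in> T \<and> deg (fst t) + deg (snd t) = Suc (deg (fst t') + deg (snd t')) \<and> g (snd t') \<le> g (snd t)"
      by (auto simp: t elim!: tensor_boundary_nz)
  next
    fix t p assume "t \<in> T"
    then have "g (snd t) \<noteq> bot" using g_eq_bot by (auto simp: T_def)
    then show "acyclic_on {..g (snd t)} p" by (rule acyclic_atMost)
  next
    fix t assume "t \<in> T"
    then show "\<kappa> t \<in> graded_chains {..g (snd t)} (int (deg (fst t) + deg (snd t)) + - int n)"
      using \<kappa>_chain by simp
  qed (use d\<kappa> sq in auto)
  then obtain \<rho> where \<rho>_all: "\<forall>t\<in>T. \<rho> t \<in> graded_chains {..g (snd t)} (int (deg (fst t) + deg (snd t)) + - int n + 1) \<and>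
               (\<forall>y. bd (\<rho> t) y = \<kappa> t y + - 1 * (\<Sum>t'\<in>UNIV. \<Delta> t t' * \<rho> t' y))"
    by blast
  have \<rho>: "\<rho> t \<in> graded_chains {..g (snd t)} (int (deg (fst t) + deg (snd t)) + - int n + 1)"
    and d\<rho>: "bd (\<rho> t) y = \<kappa> t y - (\<Sum>t'\<in>UNIV. \<Delta> t t' * \<rho> t' y)" if "t \<in> T" for t y
    using bspec[OF \<rho>_all that] by simp_all

  have cz: "c \<noteq> z" using c ab deg_z by auto
  define A where "A p = (\<Sum>x | x \<in> B \<and> deg x = p. bd (\<rho> (x, c)) x)" for p
  define \<theta> :: 'k where "\<theta> = - ((-1) ^ n)"
  \<comment> \<open>The alternative \<open>deg v < b\<close> fails for \<open>v = c\<close>, since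
    \<open>b \<le> n\<close>.\<close>
  have inT: "(x, c) \<in> T \<longleftrightarrow> a < deg x" if "x \<in> B" for x
    using that c cz ab by (auto simp: T_def)

  have diag: "bd (\<rho> (x, c)) x = (if x = c then 1 else 0)
      + \<theta> * (\<Sum>x' | x' \<in> B \<and> a < deg x'. D x x' * \<rho> (x', c) x)"
    if x: "x \<in> B" "a < deg x" for x
  proof -
    have T: "(x, c) \<in> T" using inT x by simp
    have "\<Delta> (x, c) t' * \<rho> t' x = tensor_boundary deg D (x, c) t' * (if t' \<in> T \<and> snd t' = c then \<rho> t' x else 0)" for t'
    proof (cases "t' \<in> T \<and> snd t' \<noteq> c \<and> tensor_boundary deg D (x, c) t' \<noteq> 0 \<and> \<rho> t' x \<noteq> 0")
      case False
      then show ?thesis unfolding \<Delta>_def using T by (simp split: if_split) blast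
    next
      case True
      obtain x' v' where t': "t' = (x', v')" by force
      from True have *: "t' \<in> T" "tensor_boundary deg D (x, c) (x', v') \<noteq> 0" "\<rho> t' x \<noteq> 0" "v' \<noteq> c"
        by (simp_all add: t')
      \<comment> \<open>A surviving term has \<open>v'\<close> in the boundary of \<open>c\<close>
        and \<open>g x \<le> g v'\<close>; as the join of the pair is top, so is
        \<open>g v'\<close>, against strictness.\<close>
      from *(2,4) have "x = x'" "D c v' \<noteq> 0" by (auto elim!: tensor_boundary_nz)
      moreover have "g x \<le> g v'" using graded_chains_D[OF \<rho>[OF *(1)] *(3)] by (simp add: t')
      moreover have "sup (g x') (g v') = top_class.top" using *(1) by (simp add: T_def t')
      ultimately have "g v' = top_class.top" "D c v' \<noteq> 0" by (auto simp: sup_absorb2)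
      then have False using D_strict[of c v'] c by auto
      then show ?thesis ..
    qed
    then have "(\<Sum>t'\<in>UNIV. \<Delta> (x, c) t' * \<rho> t' x)
       = (-1) ^ n * (\<Sum>x'\<in>UNIV. D x x' * (if (x', c) \<in> T then \<rho> (x', c) x else 0))
         + (\<Sum>v'\<in>UNIV. D c v' * (if (x, v') \<in> T \<and> v' = c then \<rho> (x, v') x else 0))"
      by (simp add: sum_tensor_boundary c)
    also have "(\<Sum>v'\<in>UNIV. D c v' * (if (x, v') \<in> T \<and> v' = c then \<rho> (x, v') x else 0)) = 0"
      by (intro sum.neutral) (auto simp: D_c)
    also have "(\<Sum>x'\<in>UNIV. D x x' * (if (x', c) \<in> T then \<rho> (x', c) x else 0))
       = (\<Sum>x' | x' \<in> B \<and> a < deg x'. D x x' * \<rho> (x', c) x)"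
    proof (rule sum.mono_neutral_cong_right)
      have "x' \<in> B \<and> a < deg x'" if "(x', c) \<in> T" for x'
        using that inT[of x'] by (auto simp: T_def)
      then show "\<forall>x'\<in>UNIV - {x' \<in> B. a < deg x'}. D x x' * (if (x', c) \<in> T then \<rho> (x', c) x else 0) = 0"
        by auto
    qed (use inT in auto)
    finally have "(\<Sum>t'\<in>UNIV. \<Delta> (x, c) t' * \<rho> t' x)
       = (-1) ^ n * (\<Sum>x' | x' \<in> B \<and> a < deg x'. D x x' * \<rho> (x', c) x)" by simp
    \<comment> \<open>The product term of \<open>\<kappa>\<close> sits at \<open>z\<close>, which
      differs from \<open>x\<close> because \<open>deg x > a \<ge> 0\<close>.\<close>
    moreover have "\<kappa> (x, c) x = (if x = c then 1 else 0)"
      using x deg_z by (auto simp: \<kappa>_def)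
    ultimately show ?thesis by (simp add: d\<rho>[OF T] \<theta>_def)
  qed

  have A: "A p = (if p = n then 1 else 0) + \<theta> * (if p = Suc a then 0 else A (p - 1))" if p: "a < p" for p
  proof -
    have "A p = (\<Sum>x | x \<in> B \<and> deg x = p. (if x = c then 1 else 0)
        + \<theta> * (\<Sum>x' | x' \<in> B \<and> a < deg x'. D x x' * \<rho> (x', c) x))"
      unfolding A_def using p by (intro sum.cong) (auto simp: diag)
    also have "\<dots> = (if p = n then 1 else 0)
        + \<theta> * (\<Sum>x | x \<in> B \<and> deg x = p. \<Sum>x' | x' \<in> B \<and> a < deg x'. D x x' * \<rho> (x', c) x)"
      using c by (auto simp: sum.distrib sum_distrib_left sum.delta)
    \<comment> \<open>Cyclicity of the trace: exchanging the sums turns the trace of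
      \<open>\<rho>\<close> after \<open>D\<close> in degree \<open>p\<close> into that of
      \<open>D\<close> after \<open>\<rho>\<close> in degree \<open>p - 1\<close>.\<close>
    also have "(\<Sum>x | x \<in> B \<and> deg x = p. \<Sum>x' | x' \<in> B \<and> a < deg x'. D x x' * \<rho> (x', c) x)
       = (\<Sum>x' | x' \<in> B \<and> a < deg x'. \<Sum>x | x \<in> B \<and> deg x = p. D x x' * \<rho> (x', c) x)"
      by (rule sum.swap)
    also have "\<dots> = (\<Sum>x' | x' \<in> B \<and> a < deg x' \<and> p = Suc (deg x'). bd (\<rho> (x', c)) x')"
    proof (rule sum.mono_neutral_cong_right)
      fix x' assume x': "x' \<in> {x' \<in> B. a < deg x' \<and> p = Suc (deg x')}"
      then show "(\<Sum>x | x \<in> B \<and> deg x = p. D x x' * \<rho> (x', c) x) = bd (\<rho> (x', c)) x'"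
        unfolding matrix_boundary_def
      proof (intro sum.mono_neutral_cong_left ballI)
        fix x assume "x \<in> UNIV - {x \<in> B. deg x = p}"
        then show "\<rho> (x', c) x * D x x' = 0" using D_nz[of x x'] x' by auto
      qed (auto simp: mult.commute)
    next
      show "\<forall>x'\<in>{x' \<in> B. a < deg x'} - {x' \<in> B. a < deg x' \<and> p = Suc (deg x')}.
         (\<Sum>x | x \<in> B \<and> deg x = p. D x x' * \<rho> (x', c) x) = 0"
      proof (intro ballI sum.neutral)
        fix x x' assume "x' \<in> {x' \<in> B. a < deg x'} - {x' \<in> B. a < deg x' \<and> p = Suc (deg x')}"
          "x \<in> {x \<in> B. deg x = p}"
        then show "D x x' * \<rho> (x', c) x = 0" using D_nz[of x x'] by auto
      qed
    qed auto
    also have "\<dots> = (if p = Suc a then 0 else A (p - 1))"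
    proof (cases "p = Suc a")
      case True
      then have "{x' \<in> B. a < deg x' \<and> p = Suc (deg x')} = {}" by auto
      then show ?thesis using True by (simp only: sum.empty if_True refl)
    next
      case False
      then have "{x' \<in> B. a < deg x' \<and> p = Suc (deg x')} = {x' \<in> B. deg x' = p - 1}" using p by auto
      with False show ?thesis by (simp add: A_def)
    qed
    finally show ?thesis .
  qed
  have pw: "A (n + j) = \<theta> ^ j" for j
    using ab(1) A by (rule impulse_response)
  have "\<theta> \<noteq> 0" by (simp add: \<theta>_def)
  \<comment> \<open>Beyond the maximal degree of a basis element the trace is an empty sum, while
    the recurrence makes it a power of the sign \<open>\<theta>\<close>.\<close>
  then have nz: "A (n + Suc (Max (range deg))) \<noteq> 0"
    unfolding pw by (rule power_not_zero)
  have "deg x \<noteq> n + Suc (Max (range deg))" for x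
  proof -
    have "deg x \<le> Max (range deg)" by simp
    then show ?thesis by linarith
  qed
  then have "A (n + Suc (Max (range deg))) = 0"
    unfolding A_def by (intro sum.neutral) blast
  with nz show False by contradiction
qed

section \<open>Basis elements and homology below an element\<close>

lemma D_row_not_boundary:
  assumes b: "b \<in> B" "b \<noteq> z" and u: "u \<in> graded_chains {..<g b} (int (deg b))"
  shows "\<exists>t. bd u t \<noteq> D b t"
proof (rule ccontr)
  assume "\<not> ?thesis"
  then have eq: "\<And>t. bd u t = D b t" by blast
  have bot: "g b \<noteq> bot" using g_eq_bot b by blast
  \<comment> \<open>\<open>b - u\<close> would be a cycle, hence the boundary of a chain of grade at
    most \<open>g b\<close>; by strictness such a boundary has coefficient zero at
    \<open>b\<close>.\<close>
  let ?w = "\<lambda>t. (if t = b then 1 else 0) - u t"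
  have w: "?w \<in> graded_chains {..g b} (int (deg b))"
    using b by (intro graded_chains_diff graded_chains_single graded_chains_mono[OF u]) auto
  have "bd ?w t = 0" for t by (simp add: matrix_boundary_diff matrix_boundary_single eq)
  from acyclic_onD[OF acyclic_atMost[OF bot] w this]
  obtain v where v: "v \<in> graded_chains {..g b} (int (deg b) + 1)" "\<And>t. bd v t = ?w t"
    by blast
  have "bd v b = 0" unfolding matrix_boundary_def
  proof (rule sum.neutral, rule ballI)
    fix s show "v s * D s b = 0"
      using graded_chains_D[OF v(1), of s] D_strict[of s b] by (auto simp: less_le_not_le)
  qed
  moreover have "u b = 0" using graded_chains_D[OF u, of b] by blast
  ultimately show False using v(2)[of b] by simp
qed

text \<open>Adding the basis elements of grade \<open>v\<close> makes \<open>{..<v}\<close> acyclic.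
  So they detect its homology one degree lower: the boundary of one is a nonbounding cycle, and a
  nonbounding cycle below \<open>v\<close> can only bound with their help.\<close>

lemma exists_basis_element_iff:
  assumes v: "v \<noteq> bot_class.bot"
  shows "(\<exists>c\<in>B. g c = v \<and> int (deg c) = p + 1) \<longleftrightarrow> \<not> acyclic_on {..<v} p"
proof
  assume "\<exists>c\<in>B. g c = v \<and> int (deg c) = p + 1"
  then obtain c where c: "c \<in> B" "g c = v" "int (deg c) = p + 1" by blast
  have row: "D c \<in> graded_chains {..<v} p"
  proof (rule graded_chains_I)
    fix t assume "D c t \<noteq> 0"
    with D_nz[OF this] D_strict[OF this] c show "t \<in> B \<and> g t \<in> {..<v} \<and> int (deg t) = p" by simp
  qed
  have cycle: "bd (D c) t = 0" for t by (simp add: matrix_boundary_def D_D)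
  show "\<not> acyclic_on {..<v} p"
  proof
    assume "acyclic_on {..<v} p"
    from acyclic_onD[OF this row cycle] obtain u where
      u: "u \<in> graded_chains {..<v} (p + 1)" "\<And>t. bd u t = D c t" by blast
    have "c \<noteq> z" using c(2) v g_z by auto
    moreover have "u \<in> graded_chains {..<g c} (int (deg c))" using u(1) c by simp
    ultimately show False using D_row_not_boundary[OF c(1)] u(2) by blast
  qed
next
  assume "\<not> acyclic_on {..<v} p"
  then obtain w where w: "w \<in> graded_chains {..<v} p" "\<And>t. bd w t = 0"
    and not_bd: "\<And>u. u \<in> graded_chains {..<v} (p + 1) \<Longrightarrow> \<exists>t. bd u t \<noteq> w t"
    unfolding acyclic_on_def by blast
  have "w \<in> graded_chains {..v} p" by (rule graded_chains_mono[OF w(1)]) auto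
  from acyclic_onD[OF acyclic_atMost[OF v] this w(2)] obtain u where
    u: "u \<in> graded_chains {..v} (p + 1)" "\<And>t. bd u t = w t" by blast
  show "\<exists>c\<in>B. g c = v \<and> int (deg c) = p + 1"
  proof (rule ccontr)
    assume no: "\<not> ?thesis"
    have "u \<in> graded_chains {..<v} (p + 1)"
    proof (rule graded_chains_I)
      fix b assume "u b \<noteq> 0"
      with graded_chains_D[OF u(1) this] no
      show "b \<in> B \<and> g b \<in> {..<v} \<and> int (deg b) = p + 1" by (auto simp: less_le)
    qed
    with not_bd u(2) show False by blast
  qed
qed

text \<open>By \<open>D_row_not_boundary\<close> with \<open>u = 0\<close>, a basis element other
  than \<open>z\<close> has nonzero boundary, so degrees can be descended one at a time.\<close>

lemma exists_lower_degree:
  assumes "c \<in> B" "a \<le> deg c"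
  shows "\<exists>x\<in>B. deg x = a"
  using assms
proof (induction "deg c - a" arbitrary: c)
  case 0
  then show ?case by (intro bexI[of _ c]) auto
next
  case (Suc m)
  then have "c \<noteq> z" using deg_z by auto
  have "(\<lambda>_. 0) \<in> graded_chains {..<g c} (int (deg c))" by (simp add: graded_chains_def)
  from D_row_not_boundary[OF Suc.prems(1) \<open>c \<noteq> z\<close> this] obtain t where "D c t \<noteq> 0"
    by (auto simp: matrix_boundary_zero)
  from D_nz[OF this] Suc.hyps(2) have "t \<in> B" "m = deg t - a" "a \<le> deg t" by auto
  then show ?case by (intro Suc.hyps(1))
qed

lemma exists_pair_top:
  assumes c: "c \<in> B" "g c = top_class.top" "deg c = n" and ab: "a \<le> n" "b \<le> n" "n \<le> a + b"
  shows "\<exists>x\<in>B. \<exists>y\<in>B. deg x = a \<and> deg y = b \<and> sup (g x) (g y) = top_class.top"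
proof (cases "a = n")
  case True
  \<comment> \<open>The trace argument requires \<open>a < n\<close>. For \<open>a = n\<close>,
    \<open>c\<close> itself has grade top and any element of degree \<open>b\<close> completes the
    pair.\<close>
  obtain y where "y \<in> B" "deg y = b" using exists_lower_degree[OF c(1)] c(3) ab by blast
  with True c show ?thesis by (intro bexI[of _ c] bexI[of _ y]) auto
next
  case False
  then show ?thesis using exists_pair_top_aux[OF c, of a b] ab by simp
qed

end

section \<open>Cancellation\<close>

text \<open>
  Gaussian elimination of a pair \<open>s\<close>, \<open>t\<close> with \<open>D s t \<noteq> 0\<close>. The reduced complex embeds into the
  original one by correcting the coefficient at \<open>s\<close> so that the boundary vanishes at \<open>t\<close>.
\<close>

definition cancel_matrix :: "('b \<Rightarrow> 'b \<Rightarrow> 'k::field) \<Rightarrow> 'b \<Rightarrow> 'b \<Rightarrow> 'b \<Rightarrow> 'b \<Rightarrow> 'k" where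
  "cancel_matrix D s t b b' =
     (if b \<in> {s, t} \<or> b' \<in> {s, t} then 0 else D b b' - D b t * D s b' / D s t)"

definition cancel_embed :: "('b::finite \<Rightarrow> 'b \<Rightarrow> 'k::field) \<Rightarrow> 'b \<Rightarrow> 'b \<Rightarrow> ('b \<Rightarrow> 'k) \<Rightarrow> 'b \<Rightarrow> 'k" where
  "cancel_embed D s t w b =
     (if b = s then - matrix_boundary D w t / D s t else w b)"

text \<open>With equal grades, the correction term of the reduced matrix, which runs from
  \<open>b\<close> down to \<open>t\<close>, back up to \<open>s\<close> and down to
  \<open>b'\<close>, cannot raise the grade.\<close>

locale cancellable_pair = graded_complex B g deg D
  for B :: "'b::finite set" and g :: "'b \<Rightarrow> 'a::order" and deg :: "'b \<Rightarrow> nat"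
    and D :: "'b \<Rightarrow> 'b \<Rightarrow> 'k::field" +
  fixes s t :: 'b
  assumes D_st: "D s t \<noteq> 0" and g_st: "g s = g t"
begin

abbreviation D' :: "'b \<Rightarrow> 'b \<Rightarrow> 'k" where "D' \<equiv> cancel_matrix D s t"
abbreviation B' :: "'b set" where "B' \<equiv> B - {s, t}"
abbreviation \<iota> :: "('b \<Rightarrow> 'k) \<Rightarrow> 'b \<Rightarrow> 'k" where "\<iota> \<equiv> cancel_embed D s t"

lemma st: "s \<in> B" "t \<in> B" "deg s = Suc (deg t)" "s \<noteq> t"
  using D_nz[OF D_st] by auto

lemma D_zero: "D s s = 0" "D t t = 0"
  using D_nz[of s s] D_nz[of t t] by fastforce+

lemma embed_eq: "\<iota> w = (\<lambda>b. w b - (if b = s then w s + bd w t / D s t else 0))"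
  by (auto simp: cancel_embed_def)

lemma bd_D_row: "bd (D b) c = 0"
  by (simp add: matrix_boundary_def D_D)

lemma bd_restrict:
  assumes "w s = 0" "w t = 0"
  shows "matrix_boundary D' w b = (if b \<in> {s, t} then 0 else bd w b - bd w t * D s b / D s t)"
proof -
  have "w c * D' c b = (if b \<in> {s, t} then 0 else w c * D c b - (w c * D c t) * (D s b / D s t))" for c
    using assms by (auto simp: cancel_matrix_def right_diff_distrib)
  then show ?thesis
    by (auto simp: matrix_boundary_def sum_subtractf sum_distrib_right sum_divide_distrib)
qed

lemma bd_embed:
  assumes w: "w s = 0" "w t = 0"
  shows "bd (\<iota> w) b = \<iota> (matrix_boundary D' w) b"
proof -
  have 1: "bd (\<iota> w) b = bd w b - bd w t * D s b / D s t" for b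
    unfolding embed_eq by (simp add: matrix_boundary_diff matrix_boundary_single w)
  have eq: "matrix_boundary D' w = (\<lambda>b. (bd w b - (bd w t / D s t) * D s b) - (if b = s then bd w s else 0))"
    using D_st by (auto simp: bd_restrict[OF w] D_zero fun_eq_iff)
  \<comment> \<open>This value follows from \<open>bd_bd\<close> and gives the embedded boundary its
    required coefficient \<open>bd w s\<close> at \<open>s\<close>.\<close>
  have "bd (matrix_boundary D' w) t = - (bd w s * D s t)"
    unfolding eq matrix_boundary_diff matrix_boundary_scale matrix_boundary_single
    by (simp add: bd_bd bd_D_row)
  then show ?thesis
    using D_st by (auto simp: cancel_embed_def 1 bd_restrict[OF w] D_zero)
qed

lemma embed_inject:
  assumes "\<And>b. \<iota> v b = \<iota> w b" "v s = 0" "w s = 0"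
  shows "v b = w b"
  using assms(1)[of b] assms(2,3) by (cases "b = s") (auto simp: cancel_embed_def)

lemma D'_nz: "D' b b' \<noteq> 0 \<Longrightarrow> b \<in> B' \<and> b' \<in> B' \<and> g b' \<le> g b \<and> deg b = Suc (deg b')"
proof -
  assume nz: "D' b b' \<noteq> 0"
  then have "b \<notin> {s, t}" "b' \<notin> {s, t}" by (auto simp: cancel_matrix_def)
  moreover have "D b b' \<noteq> 0 \<or> D b t \<noteq> 0 \<and> D s b' \<noteq> 0"
    using nz by (auto simp: cancel_matrix_def split: if_splits)
  ultimately show ?thesis
    using D_nz[of b b'] D_nz[of b t] D_nz[of s b'] st(3) g_st by auto
qed

text \<open>On chains without \<open>s\<close> and \<open>t\<close>, \<open>\<iota>\<close> is an
  injective chain map into a complex whose boundary squares to zero.\<close>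

lemma D'_D': "(\<Sum>c\<in>UNIV. D' b c * D' c b') = 0"
proof (cases "b \<in> {s, t}")
  case True
  then show ?thesis by (simp add: cancel_matrix_def)
next
  case False
  let ?e = "\<lambda>c. if c = b then 1 else (0::'k)"
  have e: "?e s = 0" "?e t = 0" using False by auto
  have D': "matrix_boundary D' ?e = D' b" "matrix_boundary D' (D' b) s = 0"
    by (auto simp: matrix_boundary_single fun_eq_iff) (simp add: matrix_boundary_def cancel_matrix_def)
  have z: "D' b s = 0" "D' b t = 0" by (simp_all add: cancel_matrix_def)
  have "\<iota> (matrix_boundary D' (D' b)) c = 0" for c
  proof -
    have "\<iota> (D' b) = bd (\<iota> ?e)" using bd_embed[OF e] by (auto simp: D' fun_eq_iff)
    then have "bd (\<iota> (D' b)) c = 0" by (simp add: bd_bd)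
    then show ?thesis by (simp add: bd_embed[OF z])
  qed
  moreover have "\<iota> (\<lambda>_. 0) c = 0" for c by (simp add: cancel_embed_def matrix_boundary_zero)
  ultimately have "matrix_boundary D' (D' b) b' = 0"
    using embed_inject[of "matrix_boundary D' (D' b)" "\<lambda>_. 0" b'] D'(2) by simp
  then show ?thesis by (simp add: matrix_boundary_def)
qed

sublocale cancelled: graded_complex B' g deg D'
  by unfold_locales (use D'_nz D'_D' in auto)

lemma embed_chains:
  assumes w: "w \<in> cancelled.graded_chains X p" and X: "\<forall>x\<in>X. \<forall>y\<le>x. y \<in> X"
  shows "\<iota> w \<in> graded_chains X p"
proof (rule graded_chains_I)
  fix b assume nz: "\<iota> w b \<noteq> 0"
  show "b \<in> B \<and> g b \<in> X \<and> int (deg b) = p"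
  proof (cases "b = s")
    case True
    then obtain c where c: "w c * D c t \<noteq> 0"
      using nz unfolding cancel_embed_def matrix_boundary_def
      by (metis (no_types, lifting) div_0 minus_zero sum.neutral)
    have "c \<in> B' \<and> g c \<in> X \<and> int (deg c) = p" using cancelled.graded_chains_D[OF w] c by simp
    moreover have "g t \<in> X" using calculation D_nz[of c t] c X by auto
    ultimately show ?thesis using D_nz[of c t] c st(1,3) g_st True by simp
  next
    case False
    then show ?thesis using nz cancelled.graded_chains_D[OF w, of b] by (auto simp: cancel_embed_def)
  qed
qed

text \<open>Subtracting a multiple of the boundary of \<open>s\<close> clears the coefficient at
  \<open>t\<close>. The coefficient at \<open>s\<close> is then forced by the vanishing boundary at
  \<open>t\<close>, so the rest lies in the image of \<open>\<iota>\<close>.\<close>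

lemma chain_decompose:
  assumes v: "v \<in> graded_chains X p" and X: "\<forall>x\<in>X. \<forall>y\<le>x. y \<in> X"
    and t0: "bd v t = 0"
  obtains w a where "w \<in> cancelled.graded_chains X p" "\<And>b. v b = \<iota> w b + a * D s b"
    "(\<lambda>b. if b = s then a else 0) \<in> graded_chains X (p + 1)"
proof -
  define a where "a = v t / D s t"
  define v2 where "v2 = (\<lambda>b. v b - a * D s b)"
  define w where "w = (\<lambda>b. v2 b - (if b = s then v2 s else 0))"
  have a: "g s \<in> X \<and> int (deg t) = p" if "a \<noteq> 0"
    using graded_chains_D[OF v, of t] that g_st by (auto simp: a_def)
  have "(\<lambda>b. if b = s then a else 0) \<in> graded_chains X (p + 1)"
    using a st by (auto simp: graded_chains_def)
  moreover from graded_chains_bd[OF this X]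
  have "(\<lambda>b. a * D s b) \<in> graded_chains X p" by (simp add: matrix_boundary_single[abs_def])
  then have v2: "v2 \<in> graded_chains X p" unfolding v2_def by (intro graded_chains_diff v)
  have v2t: "v2 t = 0" using D_st by (simp add: v2_def a_def)
  have w: "w \<in> cancelled.graded_chains X p"
    using graded_chains_D[OF v2] v2t by (auto simp: w_def cancelled.graded_chains_def split: if_splits)
  have "bd v2 t = 0" unfolding v2_def matrix_boundary_diff matrix_boundary_scale
    by (simp add: t0 bd_D_row)
  moreover have "bd w t = bd v2 t - v2 s * D s t"
    unfolding w_def matrix_boundary_diff matrix_boundary_single ..
  ultimately have "\<iota> w b = v2 b" for b
    using D_st by (auto simp: cancel_embed_def w_def)
  then have "v b = \<iota> w b + a * D s b" for b by (simp add: v2_def)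
  with w \<open>(\<lambda>b. if b = s then a else 0) \<in> graded_chains X (p + 1)\<close> that show thesis by blast
qed

text \<open>By \<open>chain_decompose\<close>, cycles are embedded chains up to a multiple of the
  boundary of \<open>s\<close> that bounds over \<open>X\<close>, and the same lemma pulls bounding
  chains back along \<open>\<iota>\<close>.\<close>

lemma acyclic_on_cancel:
  assumes X: "\<forall>x\<in>X. \<forall>y\<le>x. y \<in> X"
  shows "cancelled.acyclic_on X p \<longleftrightarrow> acyclic_on X p"
proof
  assume ac: "acyclic_on X p"
  show "cancelled.acyclic_on X p" unfolding cancelled.acyclic_on_def
  proof (intro ballI impI)
    fix w assume w: "w \<in> cancelled.graded_chains X p" and cyc: "\<forall>b. matrix_boundary D' w b = 0"
    have w0: "w s = 0" "w t = 0" using cancelled.graded_chains_D[OF w] by blast+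
    have i0: "\<iota> (\<lambda>_. 0) b = 0" for b by (simp add: cancel_embed_def matrix_boundary_zero)
    have "matrix_boundary D' w = (\<lambda>_. 0)" using cyc by auto
    then have "bd (\<iota> w) b = 0" for b by (simp add: bd_embed[OF w0] i0)
    from acyclic_onD[OF ac embed_chains[OF w X] this]
    obtain v where v: "v \<in> graded_chains X (p + 1)" "\<And>b. bd v b = \<iota> w b" by blast
    have "bd v t = 0" using v(2)[of t] w0 st(4) by (simp add: cancel_embed_def)
    from chain_decompose[OF v(1) X this] obtain v' a where
      v': "v' \<in> cancelled.graded_chains X (p + 1)" "\<And>b. v b = \<iota> v' b + a * D s b" by blast
    have v0: "v' s = 0" "v' t = 0" using cancelled.graded_chains_D[OF v'(1)] by blast+
    have "v = (\<lambda>b. \<iota> v' b + a * D s b)" using v'(2) by auto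
    then have "bd v b = bd (\<iota> v') b" for b
      by (simp add: matrix_boundary_add matrix_boundary_scale bd_D_row)
    then have eq: "\<iota> (matrix_boundary D' v') b = \<iota> w b" for b using v(2) by (simp add: bd_embed[OF v0])
    have "matrix_boundary D' v' s = 0" by (simp add: matrix_boundary_def cancel_matrix_def)
    from embed_inject[OF eq this w0(1)] v'(1)
    show "\<exists>u\<in>cancelled.graded_chains X (p + 1). \<forall>b. matrix_boundary D' u b = w b" by blast
  qed
next
  assume ac: "cancelled.acyclic_on X p"
  show "acyclic_on X p" unfolding acyclic_on_def
  proof (intro ballI impI)
    fix w assume w: "w \<in> graded_chains X p" and cyc: "\<forall>b. bd w b = 0"
    from chain_decompose[OF w X] cyc obtain w' a where
      w': "w' \<in> cancelled.graded_chains X p" "\<And>b. w b = \<iota> w' b + a * D s b"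
        "(\<lambda>b. if b = s then a else 0) \<in> graded_chains X (p + 1)" by blast
    have w0: "w' s = 0" "w' t = 0" using cancelled.graded_chains_D[OF w'(1)] by blast+
    have i0: "\<iota> (\<lambda>_. 0) b = 0" for b by (simp add: cancel_embed_def matrix_boundary_zero)
    have "w = (\<lambda>b. \<iota> w' b + a * D s b)" using w'(2) by auto
    then have "bd w b = bd (\<iota> w') b" for b
      by (simp add: matrix_boundary_add matrix_boundary_scale bd_D_row)
    then have eq: "\<iota> (matrix_boundary D' w') b = \<iota> (\<lambda>_. 0) b" for b
      using cyc by (simp add: bd_embed[OF w0] i0)
    have "matrix_boundary D' w' s = 0" by (simp add: matrix_boundary_def cancel_matrix_def)
    from embed_inject[OF eq this] have "matrix_boundary D' w' b = 0" for b by simp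
    from cancelled.acyclic_onD[OF ac w'(1) this] obtain v where
      v: "v \<in> cancelled.graded_chains X (p + 1)" "\<And>b. matrix_boundary D' v b = w' b" by blast
    have v0: "v s = 0" "v t = 0" using cancelled.graded_chains_D[OF v(1)] by blast+
    let ?u = "\<lambda>b. \<iota> v b + (if b = s then a else 0)"
    have "matrix_boundary D' v = w'" using v(2) by auto
    then have "bd ?u b = w b" for b
      by (simp add: matrix_boundary_add matrix_boundary_single bd_embed[OF v0] w'(2))
    moreover have "?u \<in> graded_chains X (p + 1)"
      by (intro graded_chains_add embed_chains v X w'(3))
    ultimately show "\<exists>u\<in>graded_chains X (p + 1). \<forall>b. bd u b = w b" by blast
  qed
qed

end

text \<open>An entry that violates strictness joins elements of equal grade, so its pair can be
  cancelled. Each cancellation removes two basis elements, hence the induction on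
  \<open>card B\<close>.\<close>

lemma exists_strict_reduction:
  fixes D :: "'b::finite \<Rightarrow> 'b \<Rightarrow> 'k::field"
  assumes "graded_complex B g deg D"
  shows "\<exists>B' D'. graded_complex B' g deg (D' :: 'b \<Rightarrow> 'b \<Rightarrow> 'k) \<and> B' \<subseteq> B \<and>
    (\<forall>s t. D' s t \<noteq> 0 \<longrightarrow> g t < g s) \<and>
    (\<forall>X p. (\<forall>x\<in>X. \<forall>y\<le>x. y \<in> X) \<longrightarrow>
       graded_complex.acyclic_on B' g deg D' X p = graded_complex.acyclic_on B g deg D X p)"
  using assms
proof (induction "card B" arbitrary: B D rule: less_induct)
  case less
  show ?case
  proof (cases "\<forall>s t. D s t \<noteq> 0 \<longrightarrow> g t < g s")
    case True
    with less.prems show ?thesis by blast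
  next
    case False
    interpret graded_complex B g deg D by (rule less.prems)
    from False obtain s t where st: "D s t \<noteq> 0" "\<not> g t < g s" by blast
    then have "g s = g t" using D_nz[of s t] by (auto simp: less_le)
    with st interpret cancellable_pair B g deg D s t by unfold_locales
    have "card B' < card B"
      using st D_nz[of s t] by (intro psubset_card_mono) auto
    from less.hyps[OF this cancelled.graded_complex_axioms] obtain B'' D'' where
      "graded_complex B'' g deg (D'' :: 'b \<Rightarrow> 'b \<Rightarrow> 'k)" "B'' \<subseteq> B'"
      "\<forall>s t. D'' s t \<noteq> 0 \<longrightarrow> g t < g s"
      "\<forall>X p. (\<forall>x\<in>X. \<forall>y\<le>x. y \<in> X) \<longrightarrow>
         graded_complex.acyclic_on B'' g deg D'' X p = cancelled.acyclic_on X p"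
      by blast
    then show ?thesis
      using acyclic_on_cancel by (intro exI[of _ B''] exI[of _ D'']) (auto simp del: Diff_insert)
  qed
qed

section \<open>The order complex\<close>

lemma simplicial_boundary_eq:
  fixes c :: "'a::{finite, order} set \<Rightarrow> 'k::field"
  shows "simplicial_boundary \<Delta> c \<tau> =
    (\<Sum>v\<in>- \<tau>. if insert v \<tau> \<in> \<Delta> then (-1) ^ card {w \<in> \<tau>. w < v} * c (insert v \<tau>) else 0)"
proof -
  have "simplicial_boundary \<Delta> c \<tau> =
     (\<Sum>(\<sigma>, v)\<in>(SIGMA \<sigma>:\<Delta>. {v. v \<in> \<sigma> \<and> \<sigma> - {v} = \<tau>}). (-1) ^ card {w \<in> \<sigma>. w < v} * c \<sigma>)"
    unfolding simplicial_boundary_def by (subst sum.Sigma) auto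
  also have "\<dots> = (\<Sum>v | v \<notin> \<tau> \<and> insert v \<tau> \<in> \<Delta>. (-1) ^ card {w \<in> \<tau>. w < v} * c (insert v \<tau>))"
  proof (rule sum.reindex_bij_witness[of _ "\<lambda>v. (insert v \<tau>, v)" snd])
    fix x assume "x \<in> (SIGMA \<sigma>:\<Delta>. {v. v \<in> \<sigma> \<and> \<sigma> - {v} = \<tau>})"
    then obtain \<sigma> v where x: "x = (\<sigma>, v)" "\<sigma> \<in> \<Delta>" "v \<in> \<sigma>" "\<sigma> - {v} = \<tau>" by blast
    then have "insert v \<tau> = \<sigma>" "{w \<in> \<sigma>. w < v} = {w \<in> \<tau>. w < v}" by auto
    with x show "(insert (snd x) \<tau>, snd x) = x" "snd x \<in> {v. v \<notin> \<tau> \<and> insert v \<tau> \<in> \<Delta>}"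
      "(-1) ^ card {w \<in> \<tau>. w < snd x} * c (insert (snd x) \<tau>)
         = (case x of (\<sigma>, v) \<Rightarrow> (-1) ^ card {w \<in> \<sigma>. w < v} * c \<sigma>)"
      by auto
  qed auto
  also have "\<dots> = (\<Sum>v\<in>- \<tau>. if insert v \<tau> \<in> \<Delta> then (-1) ^ card {w \<in> \<tau>. w < v} * c (insert v \<tau>) else 0)"
    by (rule sum.mono_neutral_cong_left) auto
  finally show ?thesis .
qed

lemma simplicial_boundary_cong_complex:
  fixes c :: "'a::{finite, order} set \<Rightarrow> 'k::field"
  assumes "\<And>\<sigma>. c \<sigma> \<noteq> 0 \<Longrightarrow> \<sigma> \<in> \<Delta> \<longleftrightarrow> \<sigma> \<in> \<Delta>'"
  shows "simplicial_boundary \<Delta> c = simplicial_boundary \<Delta>' c"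
proof
  fix \<tau>
  have "(if insert v \<tau> \<in> \<Delta> then e * c (insert v \<tau>) else 0)
      = (if insert v \<tau> \<in> \<Delta>' then e * c (insert v \<tau>) else 0)" for v e
    using assms[of "insert v \<tau>"] by (cases "c (insert v \<tau>) = 0") auto
  then show "simplicial_boundary \<Delta> c \<tau> = simplicial_boundary \<Delta>' c \<tau>"
    unfolding simplicial_boundary_eq by (intro sum.cong refl)
qed

section \<open>Vanishing homology in terms of cycles and boundaries\<close>

lemma trivial_poset_homology_iff:
  assumes fin: "finite P"
  shows "trivial_group (poset_homology i P :: ('a::order set \<Rightarrow> 'k::field) set monoid) \<longleftrightarrow>
     (simplicial_cycles (order_complex P) i :: ('a set \<Rightarrow> 'k) set) \<subseteq> simplicial_boundaries (order_complex P) i"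
proof -
  let ?D = "order_complex P"
  let ?Z = "simplicial_cycles ?D i :: ('a set \<Rightarrow> 'k) set"
  let ?H = "simplicial_boundaries ?D i :: ('a set \<Rightarrow> 'k) set"
  let ?C = "simplicial_chain_group ?D (i + 1) :: ('a set \<Rightarrow> 'k) monoid"
  interpret C: comm_group ?C by (rule comm_group_simplicial_chain_group)
  define coset where "coset z = {\<lambda>\<sigma>. h \<sigma> + z \<sigma> |h. h \<in> ?H}" for z
  have carrier: "carrier (poset_homology i P) = coset ` ?Z"
    unfolding poset_homology_def carrier_FactGroup
    by (intro image_cong) (auto simp: coset_def r_coset_def simplicial_chain_group_def)
  have one: "one (poset_homology i P) = ?H"
    by (simp add: poset_homology_def FactGroup_def)
  have group: "group (poset_homology i P :: ('a set \<Rightarrow> 'k) set monoid)"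
    using comm_group_poset_homology[OF fin] by (rule comm_group.axioms)
  have H_add: "(\<lambda>\<sigma>. h \<sigma> + k \<sigma>) \<in> ?H" if "h \<in> ?H" "k \<in> ?H" for h k
  proof -
    from that obtain c d where "c \<in> carrier ?C" "d \<in> carrier ?C"
      and [simp]: "h = simplicial_boundary ?D c" "k = simplicial_boundary ?D d"
      by (auto simp: simplicial_boundaries_def)
    then have "c \<otimes>\<^bsub>?C\<^esub> d \<in> carrier ?C" by simp
    then have "(\<lambda>\<sigma>. c \<sigma> + d \<sigma>) \<in> carrier ?C" by (simp add: simplicial_chain_group_def)
    then show ?thesis
      unfolding simplicial_boundaries_def by (intro image_eqI[of _ _ "\<lambda>\<sigma>. c \<sigma> + d \<sigma>"]) (simp add: simplicial_boundary_add)
  qed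
  have H_uminus: "(\<lambda>\<sigma>. - h \<sigma>) \<in> ?H" if "h \<in> ?H" for h
  proof -
    from that obtain c where c: "c \<in> carrier ?C" "h = simplicial_boundary ?D c"
      by (auto simp: simplicial_boundaries_def)
    then have "(\<lambda>\<sigma>. - c \<sigma>) \<in> carrier ?C" by (simp add: simplicial_chain_group_def)
    then show ?thesis
      unfolding simplicial_boundaries_def
      by (intro image_eqI[of _ _ "\<lambda>\<sigma>. - c \<sigma>"]) (simp add: c(2) simplicial_boundary_uminus)
  qed
  have H_0: "(\<lambda>_. 0) \<in> ?H"
    unfolding simplicial_boundaries_def
    by (rule image_eqI[of _ _ "\<lambda>_. 0"]) (auto simp: simplicial_chain_group_def simplicial_boundary_def)
  have Z_0: "(\<lambda>_. 0) \<in> ?Z"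
    by (auto simp: simplicial_cycles_def simplicial_chain_group_def simplicial_boundary_def)
  show ?thesis
  proof
    assume "trivial_group (poset_homology i P :: ('a set \<Rightarrow> 'k) set monoid)"
    then have eq: "coset ` ?Z = {?H}"
      unfolding trivial_group_def carrier one by (rule conjunct2)
    show "?Z \<subseteq> ?H"
    proof
      fix z assume "z \<in> ?Z"
      then have "coset z = ?H" using imageI[of z ?Z coset] unfolding eq by simp
      moreover have "z \<in> coset z"
        unfolding coset_def using H_0 by (intro CollectI exI[of _ "\<lambda>_. 0"]) simp
      ultimately show "z \<in> ?H" by simp
    qed
  next
    assume sub: "?Z \<subseteq> ?H"
    have coset: "coset z = ?H" if "z \<in> ?Z" for z
    proof
      have z: "z \<in> ?H" using sub that by (rule subsetD)
      show "coset z \<subseteq> ?H" using H_add[OF _ z] by (auto simp: coset_def)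
      show "?H \<subseteq> coset z"
      proof
        fix h assume "h \<in> ?H"
        then have "(\<lambda>\<sigma>. h \<sigma> + - z \<sigma>) \<in> ?H" by (rule H_add[OF _ H_uminus[OF z]])
        then show "h \<in> coset z"
          unfolding coset_def by (intro CollectI exI[of _ "\<lambda>\<sigma>. h \<sigma> + - z \<sigma>"]) simp
      qed
    qed
    have "carrier (poset_homology i P) = (\<lambda>_. ?H) ` ?Z"
      unfolding carrier by (rule image_cong[OF refl coset])
    also have "\<dots> = {?H}" using Z_0 by (rule image_constant)
    finally show "trivial_group (poset_homology i P :: ('a set \<Rightarrow> 'k) set monoid)"
      unfolding trivial_group_def one using group by (rule conjI[rotated])
  qed
qed

section \<open>The order complex graded by the tops of chains\<close>

definition chain_top :: "'a::bounded_lattice set \<Rightarrow> 'a" where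
  "chain_top \<sigma> = Sup_fin (insert bot_class.bot \<sigma>)"

definition order_matrix :: "'a::{finite, bounded_lattice} set \<Rightarrow> 'a set \<Rightarrow> 'k::field" where
  "order_matrix \<sigma> = simplicial_boundary (order_complex (UNIV - {bot_class.bot})) (\<lambda>\<rho>. if \<rho> = \<sigma> then 1 else 0)"

lemma chain_top_le_iff:
  fixes \<sigma> :: "'a::{finite, bounded_lattice} set"
  shows "chain_top \<sigma> \<le> x \<longleftrightarrow> (\<forall>y\<in>\<sigma>. y \<le> x)"
  unfolding chain_top_def by (subst Sup_fin.bounded_iff) auto

lemma chain_top_upper: "y \<in> \<sigma> \<Longrightarrow> y \<le> chain_top (\<sigma> :: 'a::{finite, bounded_lattice} set)"
  using chain_top_le_iff[of \<sigma> "chain_top \<sigma>"] by simp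

lemma chain_top_mono: "\<sigma> \<subseteq> \<tau> \<Longrightarrow> chain_top \<sigma> \<le> chain_top (\<tau> :: 'a::{finite, bounded_lattice} set)"
  unfolding chain_top_le_iff using chain_top_upper by blast

text \<open>\<open>bot\<close> is inserted in \<open>chain_top\<close> for this case: the empty
  simplex can then serve as the element \<open>z\<close> of grade \<open>bot\<close>.\<close>

lemma chain_top_empty: "chain_top {} = (bot_class.bot :: 'a::{finite, bounded_lattice})"
  by (simp add: chain_top_def)

lemma chain_top_mem:
  fixes \<sigma> :: "'a::{finite, bounded_lattice} set"
  assumes "totalp_on \<sigma> (\<le>)" "\<sigma> \<noteq> {}"
  shows "chain_top \<sigma> \<in> \<sigma>"
proof -
  obtain m where m: "m \<in> \<sigma>" "\<And>y. y \<in> \<sigma> \<Longrightarrow> m \<le> y \<Longrightarrow> m = y"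
    using finite_has_maximal[of \<sigma>] assms(2) by auto
  have "y \<le> m" if "y \<in> \<sigma>" for y
    using m(2)[OF that] totalp_onD[OF assms(1) m(1) that] by (cases "m = y") auto
  then have "chain_top \<sigma> = m"
    by (intro order_antisym chain_top_upper m(1)) (simp add: chain_top_le_iff)
  with m show ?thesis by simp
qed

text \<open>A nonempty chain contains its top, so it lies in a lower set iff its top does. Order
  complexes of subposets thus become graded parts.\<close>

lemma order_complex_lower_set:
  fixes X :: "'a::{finite, bounded_lattice} set"
  assumes X: "\<forall>x\<in>X. \<forall>y\<le>x. y \<in> X" "bot_class.bot \<in> X"
  shows "\<sigma> \<in> order_complex (X - {bot_class.bot}) \<longleftrightarrow>
    \<sigma> \<in> order_complex (UNIV - {bot_class.bot}) \<and> chain_top \<sigma> \<in> X"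
proof
  assume \<sigma>: "\<sigma> \<in> order_complex (X - {bot_class.bot})"
  then have "chain_top \<sigma> \<in> X"
    using chain_top_mem[of \<sigma>] X(2) by (cases "\<sigma> = {}") (auto simp: order_complex_def chain_top_empty)
  with \<sigma> show "\<sigma> \<in> order_complex (UNIV - {bot_class.bot}) \<and> chain_top \<sigma> \<in> X"
    by (auto simp: order_complex_def)
next
  assume \<sigma>: "\<sigma> \<in> order_complex (UNIV - {bot_class.bot}) \<and> chain_top \<sigma> \<in> X"
  have "y \<in> X" if "y \<in> \<sigma>" for y
    using chain_top_upper[OF that] \<sigma> X(1) by blast
  with \<sigma> show "\<sigma> \<in> order_complex (X - {bot_class.bot})" by (auto simp: order_complex_def)
qed

lemma matrix_boundary_order_matrix:
  fixes w :: "'a::{finite, bounded_lattice} set \<Rightarrow> 'k::field"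
  shows "matrix_boundary order_matrix w = simplicial_boundary (order_complex (UNIV - {bot_class.bot})) w"
proof
  fix \<tau> :: "'a set"
  let ?\<Delta> = "order_complex (UNIV - {bot_class.bot}) :: 'a set set"
  have "matrix_boundary order_matrix w \<tau> = (\<Sum>v\<in>- \<tau>. \<Sum>\<sigma>\<in>UNIV. if insert v \<tau> \<in> ?\<Delta> then
      w \<sigma> * ((-1) ^ card {w \<in> \<tau>. w < v} * (if insert v \<tau> = \<sigma> then 1 else 0)) else 0)"
    unfolding matrix_boundary_def order_matrix_def simplicial_boundary_eq sum_distrib_left
    by (subst sum.swap) (auto intro!: sum.cong)
  also have "\<dots> = simplicial_boundary ?\<Delta> w \<tau>"
    unfolding simplicial_boundary_eq
  proof (rule sum.cong[OF refl])
    fix v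
    show "(\<Sum>\<sigma>\<in>UNIV. if insert v \<tau> \<in> ?\<Delta> then
        w \<sigma> * ((-1) ^ card {w \<in> \<tau>. w < v} * (if insert v \<tau> = \<sigma> then 1 else 0)) else 0)
      = (if insert v \<tau> \<in> ?\<Delta> then (-1) ^ card {w \<in> \<tau>. w < v} * w (insert v \<tau>) else 0)"
      by (subst sum_single[of "insert v \<tau>"]) auto
  qed
  finally show "matrix_boundary order_matrix w \<tau> = simplicial_boundary ?\<Delta> w \<tau>" .
qed

lemma order_matrix_nz:
  fixes \<sigma> \<tau> :: "'a::{finite, bounded_lattice} set"
  assumes "(order_matrix \<sigma> \<tau> :: 'k::field) \<noteq> 0"
  shows "\<sigma> \<in> order_complex (UNIV - {bot_class.bot}) \<and> \<tau> \<in> order_complex (UNIV - {bot_class.bot})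
    \<and> chain_top \<tau> \<le> chain_top \<sigma> \<and> card \<sigma> = Suc (card \<tau>)"
proof -
  obtain v where "v \<in> - \<tau>" "insert v \<tau> \<in> order_complex (UNIV - {bot_class.bot})" "insert v \<tau> = \<sigma>"
    using assms unfolding order_matrix_def simplicial_boundary_eq
    by (elim sum.not_neutral_contains_not_neutral) (auto split: if_splits)
  then show ?thesis
    using order_complex_subset[of \<sigma> _ \<tau>] chain_top_mono[of \<tau> \<sigma>] by auto
qed

interpretation order_graded: graded_complex
    "order_complex (UNIV - {bot_class.bot}) :: 'a::{finite, bounded_lattice} set set" chain_top card
    "order_matrix :: _ \<Rightarrow> _ \<Rightarrow> 'k::field"
proof
  fix \<sigma> \<tau> :: "'a set"
  have "(\<Sum>b\<in>UNIV. order_matrix \<sigma> b * order_matrix b \<tau>) = matrix_boundary order_matrix (order_matrix \<sigma>) \<tau>"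
    by (simp add: matrix_boundary_def)
  also have "\<dots> = 0"
    unfolding matrix_boundary_order_matrix by (subst order_matrix_def) (simp add: simplicial_boundary_boundary)
  finally show "(\<Sum>b\<in>UNIV. order_matrix \<sigma> b * order_matrix b \<tau> :: 'k) = 0" .
qed (rule order_matrix_nz)

text \<open>The shift by one is that between the number of vertices of a simplex and its
  dimension.\<close>

lemma order_graded_acyclic_on_iff:
  fixes X :: "'a::{finite, bounded_lattice} set"
  assumes X: "\<forall>x\<in>X. \<forall>y\<le>x. y \<in> X" "bot_class.bot \<in> X"
  shows "order_graded.acyclic_on TYPE('k::field) X p \<longleftrightarrow>
    trivial_group (poset_homology (p - 1) (X - {bot_class.bot}) :: ('a set \<Rightarrow> 'k) set monoid)"
proof -
  let ?\<Delta> = "order_complex (X - {bot_class.bot})"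
  let ?\<Delta>\<^sub>0 = "order_complex (UNIV - {bot_class.bot}) :: 'a set set"
  have carrier: "(carrier (simplicial_chain_group ?\<Delta> (p - 1)) :: ('a set \<Rightarrow> 'k) set) = order_graded.graded_chains X p" for p
    by (auto simp: simplicial_chain_group_def order_graded.graded_chains_def order_complex_lower_set[OF X])
  have bd: "simplicial_boundary ?\<Delta> c = matrix_boundary order_matrix c"
    if "c \<in> order_graded.graded_chains X p" for c :: "'a set \<Rightarrow> 'k" and p
    unfolding matrix_boundary_order_matrix
    by (rule simplicial_boundary_cong_complex)
      (use order_graded.graded_chains_D[OF that] in \<open>auto simp: order_complex_lower_set[OF X]\<close>)
  have Z: "(simplicial_cycles ?\<Delta> (p - 1) :: ('a set \<Rightarrow> 'k) set)
      = {c \<in> order_graded.graded_chains X p. \<forall>\<tau>. matrix_boundary order_matrix c \<tau> = 0}"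
    unfolding simplicial_cycles_def carrier using bd by (auto simp: fun_eq_iff)
  have H: "(simplicial_boundaries ?\<Delta> (p - 1) :: ('a set \<Rightarrow> 'k) set)
      = matrix_boundary order_matrix ` order_graded.graded_chains X (p + 1)"
    using carrier[of "p + 1"] bd unfolding simplicial_boundaries_def by (auto intro!: image_cong)
  have "order_graded.acyclic_on TYPE('k) X p \<longleftrightarrow>
      (\<forall>w :: 'a set \<Rightarrow> 'k. w \<in> order_graded.graded_chains X p \<longrightarrow> (\<forall>\<tau>. matrix_boundary order_matrix w \<tau> = 0) \<longrightarrow>
         w \<in> matrix_boundary order_matrix ` order_graded.graded_chains X (p + 1))"
    unfolding order_graded.acyclic_on_def Ball_def
  proof (intro all_cong1 imp_cong refl)
    fix w :: "'a set \<Rightarrow> 'k"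
    show "(\<exists>u\<in>order_graded.graded_chains X (p + 1). \<forall>\<tau>. matrix_boundary order_matrix u \<tau> = w \<tau>)
        \<longleftrightarrow> w \<in> matrix_boundary order_matrix ` order_graded.graded_chains X (p + 1)"
      unfolding image_iff fun_eq_iff by (intro bex_cong[OF refl] all_cong1 eq_commute)
  qed
  then show ?thesis
    unfolding trivial_poset_homology_iff[OF finite] Z H by blast
qed

text \<open>The order complex of \<open>{..v} - {bot}\<close> is a cone with apex \<open>v\<close>.\<close>

lemma order_graded_acyclic_on_atMost:
  fixes v :: "'a::{finite, bounded_lattice}"
  assumes v: "v \<noteq> bot_class.bot"
  shows "order_graded.acyclic_on TYPE('k::field) {..v} p"
  unfolding order_graded.acyclic_on_def
proof (intro ballI impI)
  let ?\<Delta> = "order_complex (UNIV - {bot_class.bot}) :: 'a set set"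
  fix w :: "'a set \<Rightarrow> 'k"
  assume w: "w \<in> order_graded.graded_chains {..v} p"
    and cyc: "\<forall>\<tau>. matrix_boundary order_matrix w \<tau> = 0"
  \<comment> \<open>The cone operator: \<open>v\<close> is appended as the largest vertex, so
    deleting it again carries the sign \<open>(-1) ^ (card \<sigma> - 1)\<close>.\<close>
  define u where "u \<sigma> = (if v \<in> \<sigma> then (-1) ^ (card \<sigma> - 1) * w (\<sigma> - {v}) else 0)" for \<sigma>
  have le: "y \<le> v" if "w \<sigma> \<noteq> 0" "y \<in> \<sigma>" for \<sigma> y
    using order_graded.graded_chains_D[OF w that(1)] that(2) by (auto simp: chain_top_le_iff)
  have in\<Delta>: "\<sigma> \<in> ?\<Delta>" if "w \<sigma> \<noteq> 0" for \<sigma>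
    using order_graded.graded_chains_D[OF w that] by simp
  have insert\<Delta>: "insert v \<sigma> \<in> ?\<Delta>" if "w \<sigma> \<noteq> 0" for \<sigma>
    using in\<Delta>[OF that] le[OF that] v by (auto simp: order_complex_def totalp_on_def)
  have u: "u \<in> order_graded.graded_chains {..v} (p + 1)"
  proof (rule order_graded.graded_chains_I)
    fix \<sigma> assume "u \<sigma> \<noteq> 0"
    then have 1: "v \<in> \<sigma>" "w (\<sigma> - {v}) \<noteq> 0" by (auto simp: u_def split: if_splits)
    then have 2: "insert v (\<sigma> - {v}) = \<sigma>" by auto
    have "card \<sigma> = Suc (card (\<sigma> - {v}))" using 1 card_Suc_Diff1[of \<sigma> v] by simp
    moreover have "chain_top \<sigma> \<le> v" using le[OF 1(2)] by (auto simp: chain_top_le_iff)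
    ultimately show "\<sigma> \<in> ?\<Delta> \<and> chain_top \<sigma> \<in> {..v} \<and> int (card \<sigma>) = p + 1"
      using insert\<Delta>[OF 1(2)] order_graded.graded_chains_D[OF w 1(2)] 2 by simp
  qed
  have bd: "matrix_boundary order_matrix c \<tau> = (\<Sum>y\<in>- \<tau>. (-1) ^ card {x \<in> \<tau>. x < y} * c (insert y \<tau>))"
    if "c \<in> order_graded.graded_chains {..v} q" for c :: "'a set \<Rightarrow> 'k" and \<tau> q
    unfolding matrix_boundary_order_matrix simplicial_boundary_eq
    using order_graded.graded_chains_D[OF that] by (intro sum.cong) auto
  have "matrix_boundary order_matrix u \<tau> = w \<tau>" for \<tau>
  proof (cases "v \<in> \<tau>")
    case False
    \<comment> \<open>For \<open>v \<notin> \<tau>\<close> the only coface of \<open>\<tau>\<close>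
      that can carry \<open>u\<close> is \<open>insert v \<tau>\<close>.\<close>
    have "matrix_boundary order_matrix u \<tau> = (-1) ^ card {x \<in> \<tau>. x < v} * u (insert v \<tau>)"
      unfolding bd[OF u] using False
      by (subst sum.remove[of _ v]) (auto simp: u_def intro!: sum.neutral split: if_splits)
    also have "\<dots> = (-1) ^ (card {x \<in> \<tau>. x < v} + card \<tau>) * w \<tau>"
      using False by (simp add: u_def power_add)
    also have "\<dots> = w \<tau>"
    proof (cases "w \<tau> = 0")
      case False
      then have "{x \<in> \<tau>. x < v} = \<tau>" using le[OF False] \<open>v \<notin> \<tau>\<close> by (auto simp: less_le)
      then show ?thesis by simp
    qed simp
    finally show ?thesis .
  next
    case True
    define \<tau>' where "\<tau>' = \<tau> - {v}"
    have \<tau>': "insert v \<tau>' = \<tau>" "v \<notin> \<tau>'" "- \<tau>' = insert v (- \<tau>)" using True by (auto simp: \<tau>'_def)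
    have card: "card \<tau> = Suc (card \<tau>')" using \<tau>'(1,2) by auto
    have t: "(-1) ^ card {x \<in> \<tau>. x < y} * u (insert y \<tau>)
        = (-1) ^ card \<tau> * ((-1) ^ card {x \<in> \<tau>'. x < y} * w (insert y \<tau>'))" if y: "y \<in> - \<tau>" for y
    proof (cases "w (insert y \<tau>') = 0")
      case True
      have "insert y \<tau> - {v} = insert y \<tau>'" using y \<open>v \<in> \<tau>\<close> by (auto simp: \<tau>'_def)
      with True show ?thesis by (simp add: u_def)
    next
      case False
      have "insert y \<tau> - {v} = insert y \<tau>'" using y \<open>v \<in> \<tau>\<close> by (auto simp: \<tau>'_def)
      moreover have "y \<le> v" using le[OF False] by simp
      then have "{x \<in> \<tau>. x < y} = {x \<in> \<tau>'. x < y}" by (auto simp: \<tau>'_def)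
      ultimately show ?thesis using y \<open>v \<in> \<tau>\<close> by (simp add: u_def)
    qed
    \<comment> \<open>For \<open>v \<in> \<tau>\<close> the sum is evaluated by the cycle condition
      at \<open>\<tau> - {v}\<close>, whose term for the vertex \<open>v\<close> is
      \<open>w \<tau>\<close> up to sign.\<close>
    have "0 = matrix_boundary order_matrix w \<tau>'" using cyc by simp
    also have "\<dots> = (-1) ^ card {x \<in> \<tau>'. x < v} * w \<tau> + (\<Sum>y\<in>- \<tau>. (-1) ^ card {x \<in> \<tau>'. x < y} * w (insert y \<tau>'))"
      unfolding bd[OF w] \<tau>'(3) using True by (simp add: \<tau>'(1))
    also have "(-1) ^ card {x \<in> \<tau>'. x < v} * w \<tau> = (-1) ^ card \<tau>' * w \<tau>"
    proof (cases "w \<tau> = 0")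
      case False
      then have "{x \<in> \<tau>'. x < v} = \<tau>'" using le[OF False] by (auto simp: \<tau>'_def less_le)
      then show ?thesis by simp
    qed simp
    finally have eq: "(\<Sum>y\<in>- \<tau>. (-1) ^ card {x \<in> \<tau>'. x < y} * w (insert y \<tau>')) = - ((-1) ^ card \<tau>' * w \<tau>)"
      by (simp add: eq_neg_iff_add_eq_0 add.commute)
    have "matrix_boundary order_matrix u \<tau>
      = (-1) ^ card \<tau> * (\<Sum>y\<in>- \<tau>. (-1) ^ card {x \<in> \<tau>'. x < y} * w (insert y \<tau>'))"
      unfolding bd[OF u] sum_distrib_left by (intro sum.cong refl t)
    also have "\<dots> = (-1) ^ (card \<tau>' + card \<tau>') * w \<tau>"
      unfolding eq card power_add by (simp add: mult.assoc)
    also have "\<dots> = w \<tau>" by simp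
    finally show ?thesis .
  qed
  with u show "\<exists>u\<in>order_graded.graded_chains {..v} (p + 1). \<forall>\<tau>. matrix_boundary order_matrix u \<tau> = w \<tau>"
    by blast
qed

section \<open>Synors as grades of basis elements\<close>

theorem theorem5p4:
  fixes i\<^sub>1 i\<^sub>2 k :: int
  assumes "i\<^sub>1 \<ge> 1" and "i\<^sub>2 \<ge> 1" and "0 \<le> k" and "k \<le> min i\<^sub>1 i\<^sub>2"
    and "synor TYPE('k::field) (i\<^sub>1 + i\<^sub>2 - k - 1) (UNIV - {bot_class.bot})
               (top_class.top :: 'a::{finite, bounded_lattice})"
  shows "\<exists>x y :: 'a. synor TYPE('k) (i\<^sub>1 - 1) (UNIV - {bot_class.bot}) x \<and>
                     synor TYPE('k) (i\<^sub>2 - 1) (UNIV - {bot_class.bot}) y \<and>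
                     top_class.top = sup_class.sup x y"
proof -
  let ?\<Delta> = "order_complex (UNIV - {bot_class.bot}) :: 'a set set"
  have "graded_complex ?\<Delta> chain_top card (order_matrix :: 'a set \<Rightarrow> 'a set \<Rightarrow> 'k)"
    by (rule order_graded.graded_complex_axioms)
  from exists_strict_reduction[OF this] obtain B and D :: "'a set \<Rightarrow> 'a set \<Rightarrow> 'k" where
    gc: "graded_complex B chain_top card D" and B: "B \<subseteq> ?\<Delta>"
    and strict: "\<forall>s t. D s t \<noteq> 0 \<longrightarrow> chain_top t < chain_top s"
    and ac_all: "\<forall>X p. (\<forall>x\<in>X. \<forall>y\<le>x. y \<in> X) \<longrightarrow>
       graded_complex.acyclic_on B chain_top card D X p = order_graded.acyclic_on TYPE('k) X p"
    by (elim exE conjE) (rule that)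
  note ac = ac_all[THEN spec, THEN spec, THEN mp]
  interpret graded_complex B chain_top card D by (rule gc)
  \<comment> \<open>Were the empty simplex cancelled, there would be no chains of grade
    \<open>bot\<close> and degree 0, and the homology of the empty poset in degree -1 would
    vanish.\<close>
  have empty: "{} \<in> B"
  proof (rule ccontr)
    assume "{} \<notin> B"
    then have zero: "w t = 0" if "w \<in> graded_chains {bot_class.bot} 0" for w t
      using graded_chains_D[OF that, of t] by (cases "w t = 0") auto
    have low: "\<forall>x\<in>{bot_class.bot :: 'a}. \<forall>y\<le>x. y \<in> {bot_class.bot}" by (simp add: bot_unique)
    have "acyclic_on {bot_class.bot} 0"
      unfolding acyclic_on_def
    proof (intro ballI impI bexI[of _ "\<lambda>_. 0"] allI)
      fix w t assume "w \<in> graded_chains {bot_class.bot} 0"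
      then show "bd (\<lambda>_. 0) t = w t" by (simp only: matrix_boundary_zero zero)
    qed (simp add: graded_chains_def)
    then have "order_graded.acyclic_on TYPE('k) {bot_class.bot :: 'a} 0"
      unfolding ac[OF low] .
    then have "trivial_group (poset_homology (- 1) {} :: ('a set \<Rightarrow> 'k) set monoid)"
      unfolding order_graded_acyclic_on_iff[OF low singletonI] by simp
    with poset_homology_empty show False by blast
  qed
  interpret minimal_resolution B chain_top card D "{}"
  proof
    show "b = {}" if "b \<in> B" "chain_top b = bot_class.bot" for b
      using that B chain_top_mem[of b] by (auto simp: order_complex_def)
    show "acyclic_on {..v} p" if "v \<noteq> bot_class.bot" for v p
      using order_graded_acyclic_on_atMost[OF that] ac[of "{..v}"] by (auto intro: order_trans)
  qed (use strict empty chain_top_empty in auto)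

  \<comment> \<open>Dimension \<open>i - 1\<close> below \<open>x\<close> is degree
    \<open>i\<close>, and a basis element of grade \<open>x\<close> lies one degree higher.\<close>
  have synor_iff: "synor TYPE('k) i (UNIV - {bot_class.bot}) x \<longleftrightarrow>
      x \<noteq> bot_class.bot \<and> (\<exists>c\<in>B. chain_top c = x \<and> int (card c) = i + 1)" for i x
  proof (cases "x = bot_class.bot")
    case False
    have "{y \<in> UNIV - {bot_class.bot}. y < x} = {..<x} - {bot_class.bot}" by auto
    moreover have "\<forall>y\<in>{..<x}. \<forall>u\<le>y. u \<in> {..<x}" by auto
    moreover have "bot_class.bot \<in> {..<x}" using False by (simp add: bot.not_eq_extremum)
    ultimately show ?thesis
      using False ac[of "{..<x}" i] exists_basis_element_iff[OF False, of i]
        order_graded_acyclic_on_iff[of "{..<x}" i, where 'k = 'k]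
      by (simp add: synor_def)
  qed (simp add: synor_def)

  from assms(5) obtain c where c: "c \<in> B" "chain_top c = top_class.top" "int (card c) = i\<^sub>1 + i\<^sub>2 - k"
    by (auto simp: synor_iff)
  \<comment> \<open>\<open>k \<le> min i\<^sub>1 i\<^sub>2\<close> gives the two lower bounds on
    \<open>card c\<close>, and \<open>0 \<le> k\<close> the upper one.\<close>
  have "nat i\<^sub>1 \<le> card c" "nat i\<^sub>2 \<le> card c" "card c \<le> nat i\<^sub>1 + nat i\<^sub>2"
    using assms(1-4) c(3) by auto
  from exists_pair_top[OF c(1,2) refl this] obtain x y where
    xy: "x \<in> B" "y \<in> B" "card x = nat i\<^sub>1" "card y = nat i\<^sub>2"
      "sup_class.sup (chain_top x) (chain_top y) = top_class.top" by blast
  \<comment> \<open>\<open>i\<^sub>1, i\<^sub>2 \<ge> 1\<close> excludes the empty simplex, the only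
    basis element of grade \<open>bot\<close>.\<close>
  have "chain_top x \<noteq> bot_class.bot" "chain_top y \<noteq> bot_class.bot"
    using g_eq_bot[OF xy(1)] g_eq_bot[OF xy(2)] xy(3,4) assms(1,2) by auto
  with xy assms(1,2) show ?thesis
    by (intro exI[of _ "chain_top x"] exI[of _ "chain_top y"]) (auto simp: synor_iff)
qed

end
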